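(* Let $c>0$ and suppose there exists an algorithm solving all-pairs CFL reachability on graphs with $n$ vertices and grammar $G$ in time $\mathcal{O}(n^c\cdot \mathrm{poly}(|G|))$. Then for every fixed grammar $G$ (over a fixed alphabet), every $k=o(\log n)$ and every $c'>0$ there exists an algorithm solving all-pairs CFL reachability on $k$-subdivision-graphs with $n$ ordinary vertices in time $\mathcal{O}(n^{c+c'})$.
   Context: A context-free grammar is $G=(N,\Sigma,P,S)$ with size $|G|=|N|+|\Sigma|+|P|$. In a directed graph with edges labeled by symbols of $\Sigma$, a path is an $S$-path if the concatenation of its labels lies in $\mathcal{L}(G)$; all-pairs CFL reachability asks, for every ordered pair of vertices, whether there is an $S$-path between them. A graph $D$ is a subdivision-graph of $D'$ if $D$ is obtained from $D'$ by subdividing edges (replacing an edge by a directed path through new vertices); it is a $k$-subdivision-graph if every edge of $D'$ was subdivided fewer than $k$ times. The vertices of $D'$ are the ordinary vertices of $D$ and the others are additional vertices. All-pairs CFL reachability on a subdivision-graph $D$ asks for $S$-path existence (in $D$, with its edge labels) only between pairs of ordinary vertices; $n$ denotes the number of ordinary vertices. *)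

theory Defs
  imports "HOL-Library.Landau_Symbols" "HOL-Computational_Algebra.Polynomial"
begin

section \<open>Context-free grammars\<close>

datatype ('n, 't) sym = NT 'n | Tm 't

record ('n, 't) cfg =
  nonterms :: "'n set"
  terms :: "'t set"
  prods :: "('n \<times> ('n, 't) sym list) set"
  start :: 'n

definition wf_cfg :: "('n, 't) cfg \<Rightarrow> bool" where
  "wf_cfg G \<longleftrightarrow> finite (nonterms G) \<and> finite (terms G) \<and> finite (prods G) \<and>
     start G \<in> nonterms G \<and>
     (\<forall>(A, \<alpha>) \<in> prods G. A \<in> nonterms G \<and> set \<alpha> \<subseteq> NT ` nonterms G \<union> Tm ` terms G)"

inductive derives1 :: "('n, 't) cfg \<Rightarrow> ('n, 't) sym list \<Rightarrow> ('n, 't) sym list \<Rightarrow> bool"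
  for G where
  "(A, \<alpha>) \<in> prods G \<Longrightarrow> derives1 G (\<beta> @ NT A # \<gamma>) (\<beta> @ \<alpha> @ \<gamma>)"

definition lang :: "('n, 't) cfg \<Rightarrow> 't list set" where
  "lang G = {w. (derives1 G)\<^sup>*\<^sup>* [NT (start G)] (map Tm w)}"

text \<open>
  The contribution of the productions to the size is their total length rather than their
  number: right-hand sides are of unbounded length, so no algorithm that reads its grammar
  runs in time bounded in terms of the number of productions alone. As the total length is at
  least the number of productions, asking for a time bound polynomial in this size is
  the weaker requirement on an algorithm.
\<close>

definition cfg_size :: "('n, 't) cfg \<Rightarrow> nat" where
  "cfg_size G = card (nonterms G) + card (terms G) + (\<Sum>(A, \<alpha>) \<in> prods G. Suc (length \<alpha>))"


section \<open>Edge-labelled graphs and subdivisions\<close>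

text \<open>
  Parallel edges are allowed if they carry different labels.
\<close>

record ('v, 't) lgraph =
  verts :: "'v set"
  edges :: "('v \<times> 't \<times> 'v) set"

definition wf_lgraph :: "'t set \<Rightarrow> ('v, 't) lgraph \<Rightarrow> bool" where
  "wf_lgraph \<Sigma> D \<longleftrightarrow> finite (verts D) \<and> verts D \<noteq> {} \<and> edges D \<subseteq> verts D \<times> \<Sigma> \<times> verts D"

inductive labelled_path :: "('v, 't) lgraph \<Rightarrow> 'v \<Rightarrow> 't list \<Rightarrow> 'v \<Rightarrow> bool" for D where
  empty: "u \<in> verts D \<Longrightarrow> labelled_path D u [] u"
| edge: "(u, a, x) \<in> edges D \<Longrightarrow> labelled_path D x w v \<Longrightarrow> labelled_path D u (a # w) v"

definition S_path_exists :: "('n, 't) cfg \<Rightarrow> ('v, 't) lgraph \<Rightarrow> 'v \<Rightarrow> 'v \<Rightarrow> bool" where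
  "S_path_exists G D u v \<longleftrightarrow> (\<exists>w. labelled_path D u w v \<and> w \<in> lang G)"

text \<open>
  The edges of the path from \<^term>\<open>u\<close> through the vertices \<^term>\<open>xs\<close> to \<^term>\<open>v\<close>, labelled
  \<^term>\<open>as\<close> (which has one more element than \<^term>\<open>xs\<close>).
\<close>

definition path_edges :: "'v \<Rightarrow> 'v list \<Rightarrow> 't list \<Rightarrow> 'v \<Rightarrow> ('v \<times> 't \<times> 'v) set" where
  "path_edges u xs as v = set (zip (u # xs) (zip as (xs @ [v])))"

text \<open>
  The list \<^term>\<open>I e\<close> consists of the vertices that subdivide the edge \<^term>\<open>e\<close>; its length is the number
  of times \<^term>\<open>e\<close> was subdivided. The labels along the resulting path are arbitrary: the
  labels of the graph that is being subdivided only tell its parallel edges apart.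
\<close>

definition k_subdivision_graph :: "nat \<Rightarrow> ('v, 't) lgraph \<Rightarrow> ('v, 't) lgraph \<Rightarrow> bool" where
  "k_subdivision_graph k D D' \<longleftrightarrow>
     (\<exists>(I :: 'v \<times> 't \<times> 'v \<Rightarrow> 'v list) (L :: 'v \<times> 't \<times> 'v \<Rightarrow> 't list).
        (\<forall>e \<in> edges D'. distinct (I e) \<and> set (I e) \<inter> verts D' = {} \<and>
           length (L e) = Suc (length (I e)) \<and> length (I e) < k) \<and>
        (\<forall>e \<in> edges D'. \<forall>f \<in> edges D'. e \<noteq> f \<longrightarrow> set (I e) \<inter> set (I f) = {}) \<and>
        verts D = verts D' \<union> (\<Union>e \<in> edges D'. set (I e)) \<and>
        edges D = (\<Union>(u, a, v) \<in> edges D'. path_edges u (I (u, a, v)) (L (u, a, v)) v))"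


section \<open>A word RAM\<close>

text \<open>
  Algorithms are while programs over scalar variables and random-access arrays of natural
  numbers, both named by natural numbers; a program mentions finitely many of them. Every
  operation costs one unit of time. The words are bounded: execution gets stuck as soon as
  a value exceeds the bound \<^term>\<open>B\<close> that the semantics is parameterised with.
\<close>

datatype binop = Plus | Minus | Times | Div | Mod | BitAnd | BitOr | BitXor | ShiftL | ShiftR
  | Less | Equal

fun apply_binop :: "binop \<Rightarrow> nat \<Rightarrow> nat \<Rightarrow> nat" where
  "apply_binop Plus x y = x + y"
| "apply_binop Minus x y = x - y"
| "apply_binop Times x y = x * y"
| "apply_binop Div x y = x div y"
| "apply_binop Mod x y = x mod y"
| "apply_binop BitAnd x y = and x y"
| "apply_binop BitOr x y = or x y"
| "apply_binop BitXor x y = xor x y"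
| "apply_binop ShiftL x y = push_bit y x"
| "apply_binop ShiftR x y = drop_bit y x"
| "apply_binop Less x y = (if x < y then 1 else 0)"
| "apply_binop Equal x y = (if x = y then 1 else 0)"

datatype expr = Lit nat | Var nat | Read nat expr | Bin binop expr expr

datatype com =
    Skip
  | Assign nat expr
  | Write nat expr expr
  | Seq com com
  | Cond expr com com
  | While expr com

record state =
  vars :: "nat \<Rightarrow> nat"
  arrs :: "nat \<Rightarrow> nat \<Rightarrow> nat"

fun expr_val :: "state \<Rightarrow> expr \<Rightarrow> nat" where
  "expr_val s (Lit x) = x"
| "expr_val s (Var x) = vars s x"
| "expr_val s (Read a i) = arrs s a (expr_val s i)"
| "expr_val s (Bin f e1 e2) = apply_binop f (expr_val s e1) (expr_val s e2)"

fun expr_time :: "expr \<Rightarrow> nat" where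
  "expr_time (Lit x) = 1"
| "expr_time (Var x) = 1"
| "expr_time (Read a i) = 1 + expr_time i"
| "expr_time (Bin f e1 e2) = 1 + expr_time e1 + expr_time e2"

fun expr_fits :: "nat \<Rightarrow> state \<Rightarrow> expr \<Rightarrow> bool" where
  "expr_fits B s (Lit x) \<longleftrightarrow> x \<le> B"
| "expr_fits B s (Var x) \<longleftrightarrow> vars s x \<le> B"
| "expr_fits B s (Read a i) \<longleftrightarrow> expr_fits B s i \<and> arrs s a (expr_val s i) \<le> B"
| "expr_fits B s (Bin f e1 e2) \<longleftrightarrow>
     expr_fits B s e1 \<and> expr_fits B s e2 \<and> expr_val s (Bin f e1 e2) \<le> B"

text \<open>
  \<^term>\<open>exec B p s t s'\<close>: with word bound \<^term>\<open>B\<close>, the program \<^term>\<open>p\<close> started in \<^term>\<open>s\<close>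
  terminates after \<^term>\<open>t\<close> units of time in \<^term>\<open>s'\<close>.
\<close>

inductive exec :: "nat \<Rightarrow> com \<Rightarrow> state \<Rightarrow> nat \<Rightarrow> state \<Rightarrow> bool" for B where
  Skip: "exec B Skip s 1 s"
| Assign: "expr_fits B s e \<Longrightarrow>
    exec B (Assign x e) s (1 + expr_time e) (s\<lparr>vars := (vars s)(x := expr_val s e)\<rparr>)"
| Write: "expr_fits B s i \<Longrightarrow> expr_fits B s e \<Longrightarrow>
    exec B (Write a i e) s (1 + expr_time i + expr_time e)
      (s\<lparr>arrs := (arrs s)(a := (arrs s a)(expr_val s i := expr_val s e))\<rparr>)"
| Seq: "exec B p s t1 s' \<Longrightarrow> exec B q s' t2 s'' \<Longrightarrow> exec B (Seq p q) s (t1 + t2) s''"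
| CondTrue: "expr_fits B s e \<Longrightarrow> expr_val s e \<noteq> 0 \<Longrightarrow> exec B p s t s' \<Longrightarrow>
    exec B (Cond e p q) s (1 + expr_time e + t) s'"
| CondFalse: "expr_fits B s e \<Longrightarrow> expr_val s e = 0 \<Longrightarrow> exec B q s t s' \<Longrightarrow>
    exec B (Cond e p q) s (1 + expr_time e + t) s'"
| WhileFalse: "expr_fits B s e \<Longrightarrow> expr_val s e = 0 \<Longrightarrow>
    exec B (While e p) s (1 + expr_time e) s"
| WhileTrue: "expr_fits B s e \<Longrightarrow> expr_val s e \<noteq> 0 \<Longrightarrow>
    exec B p s t1 s' \<Longrightarrow> exec B (While e p) s' t2 s'' \<Longrightarrow>
    exec B (While e p) s (1 + expr_time e + t1 + t2) s''"

text \<open>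
  The input is placed in array 0, everything else is initially 0. The words have
  \<open>d \<cdot> log M\<close> bits, where \<open>M\<close> is the length of the input plus its largest entry and the
  constant \<open>d\<close> may depend on the program but not on the input.
\<close>

definition input_state :: "nat list \<Rightarrow> state" where
  "input_state xs = \<lparr>vars = (\<lambda>_. 0), arrs = (\<lambda>a i. if a = 0 \<and> i < length xs then xs ! i else 0)\<rparr>"

definition terminates_in :: "nat \<Rightarrow> com \<Rightarrow> nat list \<Rightarrow> nat \<Rightarrow> state \<Rightarrow> bool" where
  "terminates_in d p xs t s \<longleftrightarrow> exec ((length xs + Max (set xs)) ^ d) p (input_state xs) t s"


section \<open>All-pairs CFL reachability\<close>

text \<open>
  Inputs to programs have vertices, terminals and nonterminals numbered from 0. Sets of edges and
  productions are presented as lists without repetitions, in any order.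
\<close>

definition numbered_cfg :: "(nat, nat) cfg \<Rightarrow> bool" where
  "numbered_cfg G \<longleftrightarrow> wf_cfg G \<and>
     nonterms G = {..<card (nonterms G)} \<and> terms G = {..<card (terms G)}"

definition enumerates :: "'a list \<Rightarrow> 'a set \<Rightarrow> bool" where
  "enumerates xs A \<longleftrightarrow> distinct xs \<and> set xs = A"

fun encode_sym :: "(nat, nat) sym \<Rightarrow> nat" where
  "encode_sym (Tm a) = 2 * a"
| "encode_sym (NT A) = 2 * A + 1"

fun encode_prod :: "nat \<times> (nat, nat) sym list \<Rightarrow> nat list" where
  "encode_prod (A, \<alpha>) = A # length \<alpha> # map encode_sym \<alpha>"

fun encode_edge :: "nat \<times> nat \<times> nat \<Rightarrow> nat list" where
  "encode_edge (u, a, v) = [u, a, v]"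

definition encode_instance ::
  "(nat, nat) cfg \<Rightarrow> (nat \<times> (nat, nat) sym list) list \<Rightarrow> nat \<Rightarrow> (nat \<times> nat \<times> nat) list \<Rightarrow> nat list"
  where
  "encode_instance G ps n es =
     [n, card (nonterms G), card (terms G), start G, length ps, length es] @
     concat (map encode_prod ps) @ concat (map encode_edge es)"

text \<open>The input for a fixed grammar: \<^term>\<open>n\<close> ordinary and \<^term>\<open>m\<close> additional vertices.\<close>

definition encode_subdivision :: "nat \<Rightarrow> nat \<Rightarrow> (nat \<times> nat \<times> nat) list \<Rightarrow> nat list" where
  "encode_subdivision n m es = [n, m, length es] @ concat (map encode_edge es)"

text \<open>The answer is expected in array 1, as an \<open>n \<times> n\<close> matrix of zeros and ones.\<close>

definition correct_output :: "(nat, nat) cfg \<Rightarrow> (nat, nat) lgraph \<Rightarrow> nat \<Rightarrow> state \<Rightarrow> bool" where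
  "correct_output G D n s \<longleftrightarrow>
     (\<forall>u<n. \<forall>v<n. arrs s 1 (u * n + v) = (if S_path_exists G D u v then 1 else 0))"

text \<open>
  \<^term>\<open>p\<close> solves all-pairs CFL reachability, with graph and grammar as input, in time
  \<open>T n |G|\<close> on graphs with \<open>n\<close> vertices and grammar \<open>G\<close>.
\<close>

definition solves_all_pairs :: "com \<Rightarrow> (nat \<Rightarrow> nat \<Rightarrow> real) \<Rightarrow> bool" where
  "solves_all_pairs p T \<longleftrightarrow>
     (\<exists>d. \<forall>G D n ps es.
        numbered_cfg G \<and> wf_lgraph (terms G) D \<and> verts D = {..<n} \<and>
        enumerates ps (prods G) \<and> enumerates es (edges D) \<longrightarrow>
        (\<exists>t s. terminates_in d p (encode_instance G ps n es) t s \<and>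
               real t \<le> T n (cfg_size G) \<and> correct_output G D n s))"

text \<open>
  \<^term>\<open>p\<close> solves all-pairs CFL reachability for the fixed grammar \<^term>\<open>G\<close> on
  \<^term>\<open>k\<close>-subdivision-graphs in time \<open>T n\<close>, where \<open>n\<close> is the number of ordinary vertices and
  \<^term>\<open>k\<close> may depend on \<open>n\<close>. The ordinary vertices are numbered first.
\<close>

definition solves_all_pairs_on_subdivisions ::
  "(nat, nat) cfg \<Rightarrow> (nat \<Rightarrow> nat) \<Rightarrow> com \<Rightarrow> (nat \<Rightarrow> real) \<Rightarrow> bool" where
  "solves_all_pairs_on_subdivisions G k p T \<longleftrightarrow>
     (\<exists>d. \<forall>D D' n m es.
        wf_lgraph (terms G) D \<and> wf_lgraph (terms G) D' \<and> k_subdivision_graph (k n) D D' \<and>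
        verts D' = {..<n} \<and> verts D = {..<n + m} \<and> enumerates es (edges D) \<longrightarrow>
        (\<exists>t s. terminates_in d p (encode_subdivision n m es) t s \<and>
               real t \<le> T n \<and> correct_output G D n s))"

end

theory Submission
  imports Defs "HOL-Real_Asymp.Real_Asymp"
begin

text \<open>
  From an additional vertex of a subdivision-graph there is only one way to go: along a fixed word
  to a fixed ordinary vertex. Identifying additional vertices with the same word and the same
  ordinary vertex ahead does not change which words label paths between ordinary vertices, and with
  \<open>\<sigma>\<close> terminals it leaves fewer than \<open>n (\<sigma> + 1)\<^sup>k = n\<^bsup>1 + o(1)\<^esup>\<close> vertices. So the given algorithm
  runs in time \<open>n\<^bsup>c + o(1)\<^esup>\<close> on the smaller graph, with the grammar unchanged. Computing that graph
  takes time \<open>n\<^bsup>2 + o(1)\<^esup>\<close>, which is affordable because \<open>c \<ge> 2\<close>: on a complete graph the given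
  algorithm has to write \<open>n\<^sup>2\<close> ones.
\<close>

text \<open>The function \<open>k\<close> is arbitrary, so no program can be expected to compute it.
  The program works with the largest code that it actually meets; \<open>k\<close> enters only the
  analysis, as a bound on the length of words. The time bound may depend on \<open>n\<close> alone
  although the input has \<open>m\<close> additional vertices: at most n * \<sigma> * n edges are
  subdivided, each fewer than \<open>k\<close> times, so the list of edges is short enough to be
  read. Two demands of the machine model shape the rest. The given program accepts only lists of
  edges without repetitions, whereas merging makes edges coincide; a table that is zero from the
  start detects repetitions in constant time per edge. And the given program runs under the word
  bound of the merged instance, so this instance must be polynomially bounded in the original input
  for every \<open>n\<close> and with one exponent, not only for large \<open>n\<close>.\<close>

section \<open>Program verification\<close>

text \<open>The goals ask for one run, hence the existential quantifier, which includes termination.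
  The elapsed time is an argument of the postcondition, so that cost and correctness are derived
  together.\<close>

definition wp :: "nat \<Rightarrow> com \<Rightarrow> state \<Rightarrow> (nat \<Rightarrow> state \<Rightarrow> bool) \<Rightarrow> bool" where
  "wp B p s Q \<longleftrightarrow> (\<exists>t s'. exec B p s t s' \<and> Q t s')"

inductive_cases exec_SkipE: "exec B Skip s t s'"
inductive_cases exec_AssignE: "exec B (Assign x e) s t s'"
inductive_cases exec_WriteE: "exec B (Write a i e) s t s'"
inductive_cases exec_SeqE: "exec B (Seq p q) s t s'"
inductive_cases exec_CondE: "exec B (Cond e p q) s t s'"

lemma wp_Skip [simp]: "wp B Skip s Q \<longleftrightarrow> Q 1 s"
  unfolding wp_def using exec.Skip by (auto elim: exec_SkipE)

lemma wp_Assign [simp]: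
  "wp B (Assign x e) s Q \<longleftrightarrow>
     expr_fits B s e \<and> Q (1 + expr_time e) (s\<lparr>vars := (vars s)(x := expr_val s e)\<rparr>)"
  unfolding wp_def using exec.Assign by (fastforce elim: exec_AssignE)

lemma wp_Write [simp]:
  "wp B (Write a i e) s Q \<longleftrightarrow>
     expr_fits B s i \<and> expr_fits B s e \<and>
     Q (1 + expr_time i + expr_time e)
       (s\<lparr>arrs := (arrs s)(a := (arrs s a)(expr_val s i := expr_val s e))\<rparr>)"
  unfolding wp_def using exec.Write by (fastforce elim: exec_WriteE)

lemma wp_Seq [simp]:
  "wp B (Seq p q) s Q \<longleftrightarrow> wp B p s (\<lambda>t1 s1. wp B q s1 (\<lambda>t2. Q (t1 + t2)))"
  unfolding wp_def by (blast intro: exec.Seq elim: exec_SeqE)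

lemma wp_Cond [simp]:
  "wp B (Cond e p q) s Q \<longleftrightarrow>
     expr_fits B s e \<and>
     (if expr_val s e \<noteq> 0 then wp B p s (\<lambda>t. Q (1 + expr_time e + t))
      else wp B q s (\<lambda>t. Q (1 + expr_time e + t)))"
proof
  assume "wp B (Cond e p q) s Q"
  then show "expr_fits B s e \<and>
     (if expr_val s e \<noteq> 0 then wp B p s (\<lambda>t. Q (1 + expr_time e + t))
      else wp B q s (\<lambda>t. Q (1 + expr_time e + t)))"
    unfolding wp_def by (auto elim!: exec_CondE)
next
  assume "expr_fits B s e \<and>
     (if expr_val s e \<noteq> 0 then wp B p s (\<lambda>t. Q (1 + expr_time e + t))
      else wp B q s (\<lambda>t. Q (1 + expr_time e + t)))"
  then show "wp B (Cond e p q) s Q"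
    unfolding wp_def using exec.CondTrue exec.CondFalse by (simp split: if_splits) blast+
qed

lemma wp_mono: "wp B p s Q \<Longrightarrow> (\<And>t s'. Q t s' \<Longrightarrow> R t s') \<Longrightarrow> wp B p s R"
  unfolding wp_def by blast

lemma wp_While_False:
  "expr_fits B s e \<Longrightarrow> expr_val s e = 0 \<Longrightarrow> Q (1 + expr_time e) s \<Longrightarrow> wp B (While e p) s Q"
  unfolding wp_def using exec.WhileFalse by blast

lemma wp_While_True:
  assumes "expr_fits B s e" "expr_val s e \<noteq> 0"
    and "wp B p s (\<lambda>t1 s1. wp B (While e p) s1 (\<lambda>t2. Q (1 + expr_time e + t1 + t2)))"
  shows "wp B (While e p) s Q"
proof -
  obtain t1 s1 t2 s2 where "exec B p s t1 s1" "exec B (While e p) s1 t2 s2"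
    "Q (1 + expr_time e + t1 + t2) s2"
    using assms(3) unfolding wp_def by blast
  then show ?thesis
    unfolding wp_def using exec.WhileTrue[OF assms(1,2)] by blast
qed

text \<open>For loops whose number of passes is known beforehand. The index \<open>i\<close> is a
  ghost, \<open>c\<close> bounds the cost of one pass, and the last summand pays for the guard that
  fails.\<close>

lemma wp_While_upto:
  assumes step: "\<And>i s. a \<le> i \<Longrightarrow> i < b \<Longrightarrow> I i s \<Longrightarrow>
      expr_fits B s e \<and> expr_val s e \<noteq> 0 \<and> wp B p s (\<lambda>t s'. t \<le> c \<and> I (Suc i) s')"
    and exit: "\<And>s. I b s \<Longrightarrow> expr_fits B s e \<and> expr_val s e = 0"
    and "I a s" "a \<le> b"
  shows "wp B (While e p) s (\<lambda>t s'. t \<le> (b - a) * (1 + expr_time e + c) + (1 + expr_time e) \<and> I b s')"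
  using \<open>a \<le> b\<close> order.refl[of a] \<open>I a s\<close>
proof (induction a arbitrary: s rule: inc_induct)
  case base
  then show ?case
    using exit by (auto intro: wp_While_False)
next
  case (step i)
  have "wp B p s (\<lambda>t1 s1. wp B (While e p) s1 (\<lambda>t2 s2.
      1 + expr_time e + t1 + t2 \<le> (b - i) * (1 + expr_time e + c) + (1 + expr_time e) \<and> I b s2))"
  proof (rule wp_mono)
    show "wp B p s (\<lambda>t s'. t \<le> c \<and> I (Suc i) s')"
      using assms(1) step by auto
    fix t1 s1
    assume t1: "t1 \<le> c \<and> I (Suc i) s1"
    have "wp B (While e p) s1
      (\<lambda>t s'. t \<le> (b - Suc i) * (1 + expr_time e + c) + (1 + expr_time e) \<and> I b s')"
      using step t1 by auto
    then show "wp B (While e p) s1 (\<lambda>t2 s2.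
      1 + expr_time e + t1 + t2 \<le> (b - i) * (1 + expr_time e + c) + (1 + expr_time e) \<and> I b s2)"
    proof (rule wp_mono)
      fix t2 s2
      assume "t2 \<le> (b - Suc i) * (1 + expr_time e + c) + (1 + expr_time e) \<and> I b s2"
      moreover have "(b - i) * (1 + expr_time e + c) =
          (1 + expr_time e + c) + (b - Suc i) * (1 + expr_time e + c)"
        using step mult_Suc[of "b - Suc i" "1 + expr_time e + c"] Suc_diff_Suc[of i b] by metis
      ultimately show "1 + expr_time e + t1 + t2 \<le> (b - i) * (1 + expr_time e + c) + (1 + expr_time e)
          \<and> I b s2"
        using t1 by linarith
    qed
  qed
  then show ?case
    using wp_While_True step assms(1) by auto
qed

lemma expr_fits_mono: "expr_fits B s e \<Longrightarrow> B \<le> B' \<Longrightarrow> expr_fits B' s e"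
  by (induction e) auto

text \<open>The given program is known to run under the word bound of its own input, the merged
  instance, but it is executed under a bound that belongs to the original input.\<close>

lemma exec_mono: "exec B p s t s' \<Longrightarrow> B \<le> B' \<Longrightarrow> exec B' p s t s'"
  by (induction rule: exec.induct) (blast intro: exec.intros expr_fits_mono)+

section \<open>Time spent and array cells changed\<close>

definition changed :: "nat \<Rightarrow> state \<Rightarrow> state \<Rightarrow> nat set" where
  "changed a s s' = {i. arrs s' a i \<noteq> arrs s a i}"

lemma changed_trans:
  assumes "finite (changed a s s')" "finite (changed a s' s'')"
  shows "finite (changed a s s'')"
    and "card (changed a s s'') \<le> card (changed a s s') + card (changed a s' s'')"
proof -
  have sub: "changed a s s'' \<subseteq> changed a s s' \<union> changed a s' s''"
    by (auto simp: changed_def)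
  then show "finite (changed a s s'')"
    using assms finite_subset by blast
  show "card (changed a s s'') \<le> card (changed a s s') + card (changed a s' s'')"
    using card_mono[OF _ sub] card_Un_le[of "changed a s s'" "changed a s' s''"] assms by simp
qed

text \<open>Only \<open>Write\<close> alters arrays, one cell at a time and at a cost of at least 1.
  This turns the size of the output into a lower bound on the time.\<close>

lemma exec_card_changed:
  assumes "exec B p s t s'"
  shows "finite (changed a s s') \<and> card (changed a s s') \<le> t"
  using assms
proof (induction rule: exec.induct)
  case (Write s i e b)
  have "changed a s (s\<lparr>arrs := (arrs s)(b := (arrs s b)(expr_val s i := expr_val s e))\<rparr>)
      \<subseteq> {expr_val s i}"
    by (auto simp: changed_def)
  from card_mono[OF _ this] finite_subset[OF this] show ?case by simp
next
  case (Seq p s t1 s' q t2 s'')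
  then show ?case using changed_trans[of a s s' s''] by simp
next
  case (WhileTrue s e p t1 s' t2 s'')
  then show ?case using changed_trans[of a s s' s''] by simp
qed (auto simp: changed_def)

subsection \<open>Renaming\<close>

fun shift_expr :: "nat \<Rightarrow> nat \<Rightarrow> expr \<Rightarrow> expr" where
  "shift_expr h k (Lit x) = Lit x"
| "shift_expr h k (Var x) = Var (x + h)"
| "shift_expr h k (Read a e) = Read (a + k) (shift_expr h k e)"
| "shift_expr h k (Bin f e1 e2) = Bin f (shift_expr h k e1) (shift_expr h k e2)"

fun shift_com :: "nat \<Rightarrow> nat \<Rightarrow> com \<Rightarrow> com" where
  "shift_com h k Skip = Skip"
| "shift_com h k (Assign x e) = Assign (x + h) (shift_expr h k e)"
| "shift_com h k (Write a i e) = Write (a + k) (shift_expr h k i) (shift_expr h k e)"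
| "shift_com h k (Seq p q) = Seq (shift_com h k p) (shift_com h k q)"
| "shift_com h k (Cond e p q) = Cond (shift_expr h k e) (shift_com h k p) (shift_com h k q)"
| "shift_com h k (While e p) = While (shift_expr h k e) (shift_com h k p)"

definition shifted :: "nat \<Rightarrow> nat \<Rightarrow> state \<Rightarrow> state \<Rightarrow> bool" where
  "shifted h k s S \<longleftrightarrow> (\<forall>x. vars S (x + h) = vars s x) \<and> (\<forall>a. arrs S (a + k) = arrs s a)"

definition agree_below :: "nat \<Rightarrow> nat \<Rightarrow> state \<Rightarrow> state \<Rightarrow> bool" where
  "agree_below h k s s' \<longleftrightarrow> (\<forall>x<h. vars s x = vars s' x) \<and> (\<forall>a<k. arrs s a = arrs s' a)"

lemma shift_expr_time [simp]: "expr_time (shift_expr h k e) = expr_time e"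
  by (induction e) auto

lemma shift_expr_val: "shifted h k s S \<Longrightarrow> expr_val S (shift_expr h k e) = expr_val s e"
  by (induction e) (auto simp: shifted_def)

lemma shift_expr_fits: "shifted h k s S \<Longrightarrow> expr_fits B S (shift_expr h k e) = expr_fits B s e"
proof (induction e)
  case (Read a e)
  then show ?case by (simp add: shift_expr_val) (simp add: shifted_def)
next
  case (Bin f e1 e2)
  then show ?case by (simp add: shift_expr_val)
qed (auto simp: shifted_def)

text \<open>The renamed program mentions no variable below \<open>h\<close> and no array below
  \<open>k\<close>. The resulting frame \<open>agree_below\<close> lets the surrounding program keep
  its own data across the run.\<close>

lemma exec_shift_com:
  assumes "exec B p s t s'" "shifted h k s S"
  shows "\<exists>S'. exec B (shift_com h k p) S t S' \<and> shifted h k s' S' \<and> agree_below h k S S'"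
  using assms
proof (induction arbitrary: S rule: exec.induct)
  case (Skip s)
  then show ?case
    by (intro exI[of _ S]) (auto intro!: exec.Skip[unfolded One_nat_def] simp: agree_below_def)
next
  case (Assign s e x)
  note [simp] = shift_expr_val[OF Assign(2)] shift_expr_fits[OF Assign(2)]
  show ?case
    using exec.Assign[of B S "shift_expr h k e" "x + h"] Assign
    by (intro exI[of _ "S\<lparr>vars := (vars S)(x + h := expr_val s e)\<rparr>"])
      (simp add: shifted_def agree_below_def)
next
  case (Write s i e a)
  note [simp] = shift_expr_val[OF Write(3)] shift_expr_fits[OF Write(3)]
  show ?case
    using exec.Write[of B S "shift_expr h k i" "shift_expr h k e" "a + k"] Write
    by (intro exI[of _ "S\<lparr>arrs := (arrs S)(a + k := (arrs S (a + k))(expr_val s i := expr_val s e))\<rparr>"])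
      (simp add: shifted_def agree_below_def)
next
  case (Seq p s t1 s' q t2 s'')
  then obtain S' where S': "exec B (shift_com h k p) S t1 S'" "shifted h k s' S'"
    "agree_below h k S S'" by blast
  with Seq obtain S'' where "exec B (shift_com h k q) S' t2 S''"
    "shifted h k s'' S''" "agree_below h k S' S''" by blast
  with S' show ?case
    using exec.Seq[of B "shift_com h k p" S t1 S' "shift_com h k q" t2 S'']
    by (auto simp: agree_below_def)
next
  case (CondTrue s e p t s' q)
  note [simp] = shift_expr_val[OF CondTrue(5)] shift_expr_fits[OF CondTrue(5)]
  show ?case
    using exec.CondTrue[of B S "shift_expr h k e" "shift_com h k p"] CondTrue by fastforce
next
  case (CondFalse s e q t s' p)
  note [simp] = shift_expr_val[OF CondFalse(5)] shift_expr_fits[OF CondFalse(5)]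
  show ?case
    using exec.CondFalse[of B S "shift_expr h k e" "shift_com h k q"] CondFalse by fastforce
next
  case (WhileFalse s e p)
  note [simp] = shift_expr_val[OF WhileFalse(3)] shift_expr_fits[OF WhileFalse(3)]
  show ?case
    using exec.WhileFalse[of B S "shift_expr h k e" "shift_com h k p"] WhileFalse
    by (intro exI[of _ S]) (auto simp: agree_below_def)
next
  case (WhileTrue s e p t1 s' t2 s'')
  note [simp] = shift_expr_val[OF WhileTrue(7)] shift_expr_fits[OF WhileTrue(7)]
  from WhileTrue obtain S' where S': "exec B (shift_com h k p) S t1 S'" "shifted h k s' S'"
    "agree_below h k S S'" by blast
  with WhileTrue obtain S'' where "exec B (shift_com h k (While e p)) S' t2 S''"
    "shifted h k s'' S''" "agree_below h k S' S''" by blast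
  with S' WhileTrue show ?case
    using exec.WhileTrue[of B S "shift_expr h k e" "shift_com h k p" t1 S' t2 S'']
    by (auto simp: agree_below_def)
qed

section \<open>Merging the additional vertices\<close>

text \<open>Bijective numeration in base \<^term>\<open>\<sigma>\<close>, so that every positive number is the code of a nonempty word.\<close>

fun word_code :: "nat \<Rightarrow> nat list \<Rightarrow> nat" where
  "word_code \<sigma> [] = 0"
| "word_code \<sigma> (a # w) = \<sigma> * word_code \<sigma> w + a + 1"

text \<open>Digits run from 1 to \<sigma>, so powers of \<sigma> are too small as a bound: for
  \<sigma> = 1 the code is the length. With \<sigma> + 1 the induction step even has (\<sigma> + 1)
  ^ length w to spare.\<close>

lemma word_code_less: "set w \<subseteq> {..<\<sigma>} \<Longrightarrow> word_code \<sigma> w < (\<sigma> + 1) ^ length w"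
proof (induction w)
  case (Cons a w)
  then have "word_code \<sigma> w + 1 \<le> (\<sigma> + 1) ^ length w" "a + 1 \<le> \<sigma>"
    by auto
  then have "\<sigma> * (word_code \<sigma> w + 1) \<le> \<sigma> * (\<sigma> + 1) ^ length w"
    using mult_le_mono2 by blast
  moreover have "(\<sigma> + 1) ^ length w > 0" by simp
  moreover have "(\<sigma> + 1) ^ length (a # w) = \<sigma> * (\<sigma> + 1) ^ length w + (\<sigma> + 1) ^ length w"
    by (simp add: algebra_simps)
  moreover have "word_code \<sigma> (a # w) = \<sigma> * word_code \<sigma> w + a + 1"
    "\<sigma> * (word_code \<sigma> w + 1) = \<sigma> * word_code \<sigma> w + \<sigma>"
    by simp_all
  ultimately show ?case
    using \<open>a + 1 \<le> \<sigma>\<close> by linarith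
qed simp

section \<open>Subdivision-graphs as forced paths\<close>

lemma path_edges_iff:
  assumes "length as = Suc (length xs)"
  shows "(x, a, y) \<in> path_edges u xs as v \<longleftrightarrow>
    (\<exists>i\<le>length xs. x = (u # xs) ! i \<and> a = as ! i \<and> y = (xs @ [v]) ! i)"
proof -
  have "(x, a, y) \<in> path_edges u xs as v \<longleftrightarrow>
      (\<exists>i<Suc (length xs). (x, a, y) = ((u # xs) ! i, as ! i, (xs @ [v]) ! i))"
    unfolding path_edges_def set_zip using assms by (auto 0 3 simp: nth_append)
  then show ?thesis
    by (auto simp: less_Suc_eq_le)
qed

lemma card_path_edges_le:
  assumes "length as = Suc (length xs)"
  shows "card (path_edges u xs as v) \<le> Suc (length xs)"
  using assms card_length[of "zip (u # xs) (zip as (xs @ [v]))"] by (auto simp: path_edges_def)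

text \<open>
  The vertex \<^term>\<open>x\<close> of a subdivision-graph leads, without a choice, to the ordinary vertex
  \<^term>\<open>tgt x\<close> along a path labelled \<^term>\<open>word x\<close>.
\<close>

locale subdivided_graph =
  fixes V V' :: "'v set" and E :: "('v \<times> 't \<times> 'v) set" and \<Sigma> :: "'t set" and K :: nat
    and tgt :: "'v \<Rightarrow> 'v" and word :: "'v \<Rightarrow> 't list"
  assumes edges: "E \<subseteq> V \<times> \<Sigma> \<times> V"
    and tgt_ordinary: "x \<in> V' \<Longrightarrow> tgt x = x"
    and word_ordinary: "x \<in> V' \<Longrightarrow> word x = []"
    and out_edge: "x \<in> V \<Longrightarrow> x \<notin> V' \<Longrightarrow> \<exists>a y. (x, a, y) \<in> E"
    and in_edge: "x \<in> V \<Longrightarrow> x \<notin> V' \<Longrightarrow> \<exists>u a. (u, a, x) \<in> E"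
    and word_additional: "(x, a, y) \<in> E \<Longrightarrow> x \<notin> V' \<Longrightarrow> word x = a # word y"
    and tgt_additional: "(x, a, y) \<in> E \<Longrightarrow> x \<notin> V' \<Longrightarrow> tgt x = tgt y"
    and out_edge_unique: "(x, a, y) \<in> E \<Longrightarrow> (x, b, z) \<in> E \<Longrightarrow> x \<notin> V' \<Longrightarrow> a = b \<and> y = z"
    and length_word: "x \<in> V \<Longrightarrow> length (word x) \<le> K"
begin

text \<open>Every edge taken from an additional vertex removes one letter, so induction on the word
  follows the forced path to its end. An empty word means that the vertex is ordinary, since the
  word of an additional vertex starts with the label of its edge.\<close>

lemma word_tgt_closed: "x \<in> V \<Longrightarrow> set (word x) \<subseteq> \<Sigma> \<and> tgt x \<in> V'"
proof (induction "word x" arbitrary: x)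
  case Nil
  then show ?case
    using out_edge word_additional tgt_ordinary by fastforce
next
  case (Cons b w)
  then have "x \<notin> V'" using word_ordinary by fastforce
  with Cons out_edge obtain a y where "(x, a, y) \<in> E" by blast
  with Cons \<open>x \<notin> V'\<close> edges show ?case
    using word_additional[of x a y] tgt_additional[of x a y] by auto
qed

end

text \<open>Distinctness within one edge and disjointness between edges give every additional vertex
  a unique position \<open>(e, i)\<close>. From there the way ahead is the rest of the labels of
  \<open>e\<close>, up to the end of \<open>e\<close>.\<close>

lemma k_subdivision_graph_subdivided:
  assumes D: "wf_lgraph \<Sigma> D" and D': "wf_lgraph \<Sigma> D'" and k: "k_subdivision_graph k D D'"
  obtains tgt word where
    "subdivided_graph (verts D) (verts D') (edges D) \<Sigma> k tgt word"
proof -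
  obtain I L where
    IL: "\<forall>e \<in> edges D'. distinct (I e) \<and> set (I e) \<inter> verts D' = {} \<and>
           length (L e) = Suc (length (I e)) \<and> length (I e) < k"
      "\<forall>e \<in> edges D'. \<forall>f \<in> edges D'. e \<noteq> f \<longrightarrow> set (I e) \<inter> set (I f) = {}"
      "verts D = verts D' \<union> (\<Union>e \<in> edges D'. set (I e))"
      "edges D = (\<Union>(u, a, v) \<in> edges D'. path_edges u (I (u, a, v)) (L (u, a, v)) v)"
    using k unfolding k_subdivision_graph_def by (elim exE conjE) (rule that)
  note V = IL(3) and E = IL(4)
  have I: "distinct (I e) \<and> set (I e) \<inter> verts D' = {} \<and>
      length (L e) = Suc (length (I e)) \<and> length (I e) < k" if "e \<in> edges D'" for e
    using IL(1) that by blast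
  have disj: "set (I e) \<inter> set (I f) = {}" if "e \<in> edges D'" "f \<in> edges D'" "e \<noteq> f" for e f
    using IL(2) that by blast
  let ?at = "\<lambda>x (e, i). e \<in> edges D' \<and> i < length (I e) \<and> I e ! i = x"
  define pos where "pos x = (SOME ei. ?at x ei)" for x
  define tgt where "tgt x = (if x \<in> verts D' then x else snd (snd (fst (pos x))))" for x
  \<comment> \<open>Label \<open>i\<close> of \<open>L e\<close> enters the vertex
    \<open>I e ! i\<close>, so the labels ahead start at \<open>Suc i\<close>.\<close>
  define word where "word x = (if x \<in> verts D' then [] else drop (Suc (snd (pos x))) (L (fst (pos x))))" for x
  have pos: "pos x = (e, i)" if "?at x (e, i)" for x e i
  proof -
    have "?at x (pos x)"
      unfolding pos_def by (rule someI[where P = "?at x" and x = "(e, i)"]) (use that in simp)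
    then obtain f j where f: "pos x = (f, j)" "?at x (f, j)" by (cases "pos x") auto
    then have at: "f \<in> edges D'" "j < length (I f)" "I f ! j = x"
      "e \<in> edges D'" "i < length (I e)" "I e ! i = x"
      using that by simp_all
    then have "x \<in> set (I f) \<inter> set (I e)"
      using nth_mem[of j "I f"] nth_mem[of i "I e"] by auto
    then have "f = e"
      using disj[of f e] at(1,4) by auto
    moreover from this have "j = i"
      using at I[of e] nth_eq_iff_index_eq[of "I e" j i] by simp
    ultimately show ?thesis using f(1) by simp
  qed
  have nth_additional: "I e ! i \<notin> verts D'" if "e \<in> edges D'" "i < length (I e)" for e i
    using I[OF that(1)] that(2) nth_mem[OF that(2)] by blast
  have word_nth: "word (I e ! i) = drop (Suc i) (L e)" and tgt_nth: "tgt (I e ! i) = snd (snd e)"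
    if "e \<in> edges D'" "i < length (I e)" for e i
    using pos[of "I e ! i" e i] that nth_additional[OF that] by (auto simp: word_def tgt_def)
  have edge_iff: "(x, b, y) \<in> edges D \<longleftrightarrow> (\<exists>u a v i. (u, a, v) \<in> edges D' \<and>
      i \<le> length (I (u, a, v)) \<and> x = (u # I (u, a, v)) ! i \<and> b = L (u, a, v) ! i \<and>
      y = (I (u, a, v) @ [v]) ! i)" for x b y
  proof -
    have "(x, b, y) \<in> edges D \<longleftrightarrow>
        (\<exists>u a v. (u, a, v) \<in> edges D' \<and> (x, b, y) \<in> path_edges u (I (u, a, v)) (L (u, a, v)) v)"
      unfolding E by fastforce
    also have "\<dots> \<longleftrightarrow> (\<exists>u a v i. (u, a, v) \<in> edges D' \<and>
      i \<le> length (I (u, a, v)) \<and> x = (u # I (u, a, v)) ! i \<and> b = L (u, a, v) ! i \<and>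
      y = (I (u, a, v) @ [v]) ! i)"
      using path_edges_iff[OF conjunct1[OF conjunct2[OF conjunct2[OF I]]]] by (simp cong: conj_cong)
    finally show ?thesis .
  qed
  have additional_edge: "\<exists>e i. e \<in> edges D' \<and> i < length (I e) \<and> x = I e ! i \<and> b = L e ! Suc i \<and>
      y = (I e @ [snd (snd e)]) ! Suc i" if "(x, b, y) \<in> edges D" "x \<notin> verts D'" for x b y
  proof -
    from that(1) obtain u a v i where e: "(u, a, v) \<in> edges D'"
      "i \<le> length (I (u, a, v))" "x = (u # I (u, a, v)) ! i" "b = L (u, a, v) ! i"
      "y = (I (u, a, v) @ [v]) ! i"
      unfolding edge_iff by blast
    have "u \<in> verts D'" using e(1) D' by (auto simp: wf_lgraph_def)
    \<comment> \<open>Index 0 in \<open>u # I e\<close> is the ordinary vertex \<open>u\<close>, so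
      an additional source has a positive index.\<close>
    with e that(2) obtain j where "i = Suc j" by (cases i) auto
    with e show ?thesis by (intro exI[of _ "(u, a, v)"] exI[of _ j]) auto
  qed
  have "subdivided_graph (verts D) (verts D') (edges D) \<Sigma> k tgt word"
  proof
    show "edges D \<subseteq> verts D \<times> \<Sigma> \<times> verts D"
      using D by (simp add: wf_lgraph_def)
  next
    fix x assume "x \<in> verts D" "x \<notin> verts D'"
    then obtain e i where "e \<in> edges D'" "i < length (I e)" "x = I e ! i"
      using V by (auto simp: in_set_conv_nth)
    then show "\<exists>a y. (x, a, y) \<in> edges D"
      unfolding edge_iff by (cases e) (fastforce intro: exI[of _ "Suc i"])
    show "\<exists>u a. (u, a, x) \<in> edges D"
      unfolding edge_iff using \<open>e \<in> edges D'\<close> \<open>i < length (I e)\<close> \<open>x = I e ! i\<close>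
      by (cases e) (fastforce simp: nth_append intro: exI[of _ i])
  next
    fix x b y assume xy: "(x, b, y) \<in> edges D" "x \<notin> verts D'"
    from additional_edge[OF this] obtain e i where e: "e \<in> edges D'" "i < length (I e)"
      "x = I e ! i" "b = L e ! Suc i" "y = (I e @ [snd (snd e)]) ! Suc i" by blast
    have len: "length (L e) = Suc (length (I e))" using I e by blast
    have "snd (snd e) \<in> verts D'" using e(1) D' by (auto simp: wf_lgraph_def)
    \<comment> \<open>If \<open>x\<close> is the last vertex subdividing \<open>e\<close>, then
      \<open>y\<close> is the end of \<open>e\<close>; the list that remains is empty, as the word
      of an ordinary vertex has to be.\<close>
    then have y: "word y = drop (Suc (Suc i)) (L e) \<and> tgt y = snd (snd e)"
      using e len word_nth[of e "Suc i"] tgt_nth[of e "Suc i"]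
      by (cases "Suc i < length (I e)") (auto simp: nth_append word_def tgt_def)
    show "word x = b # word y"
      using e y len word_nth[of e i] by (simp add: Cons_nth_drop_Suc)
    show "tgt x = tgt y"
      using e y tgt_nth[of e i] by simp
    fix c z assume "(x, c, z) \<in> edges D"
    from additional_edge[OF this xy(2)] obtain f j where f: "f \<in> edges D'" "j < length (I f)"
      "x = I f ! j" "c = L f ! Suc j" "z = (I f @ [snd (snd f)]) ! Suc j" by blast
    have "(e, i) = (f, j)" using pos[of x e i] pos[of x f j] e f by simp
    then show "b = c \<and> y = z" using e f by simp
  next
    fix x assume "x \<in> verts D"
    then consider "x \<in> verts D'" |
      e i where "e \<in> edges D'" "i < length (I e)" "x = I e ! i"
      using V by (auto simp: in_set_conv_nth)
    then show "length (word x) \<le> k"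
    proof cases
      case 2
      then show ?thesis using word_nth[of e i] I[of e] by auto
    qed (simp add: word_def)
  qed (auto simp: tgt_def word_def)
  then show thesis by (rule that)
qed

text \<open>No additional vertices are counted here, which makes a time bound in \<open>n\<close>
  alone possible. Parallel edges of \<open>D'\<close> differ in their labels, hence the factor
  \<open>card \<Sigma>\<close>; fewer than \<open>k\<close> subdivisions turn an edge into at most
  \<open>k\<close> edges.\<close>

lemma k_subdivision_graph_card_edges:
  assumes D': "wf_lgraph \<Sigma> D'" and \<Sigma>: "finite \<Sigma>" and k: "k_subdivision_graph k D D'"
  shows "card (edges D) \<le> card (verts D') * card \<Sigma> * card (verts D') * k"
proof -
  obtain I L where
    IL: "\<forall>e \<in> edges D'. distinct (I e) \<and> set (I e) \<inter> verts D' = {} \<and>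
           length (L e) = Suc (length (I e)) \<and> length (I e) < k"
      "\<forall>e \<in> edges D'. \<forall>f \<in> edges D'. e \<noteq> f \<longrightarrow> set (I e) \<inter> set (I f) = {}"
      "verts D = verts D' \<union> (\<Union>e \<in> edges D'. set (I e))"
      "edges D = (\<Union>(u, a, v) \<in> edges D'. path_edges u (I (u, a, v)) (L (u, a, v)) v)"
    using k unfolding k_subdivision_graph_def by (elim exE conjE) (rule that)
  note E = IL(4)
  have I: "length (L e) = Suc (length (I e)) \<and> length (I e) < k" if "e \<in> edges D'" for e
    using IL(1) that by blast
  have sub: "edges D' \<subseteq> verts D' \<times> \<Sigma> \<times> verts D'"
    and fin: "finite (verts D' \<times> \<Sigma> \<times> verts D')"
    using D' \<Sigma> by (auto simp: wf_lgraph_def)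
  have "card (edges D) \<le>
      (\<Sum>e\<in>edges D'. card (case e of (u, a, v) \<Rightarrow> path_edges u (I (u, a, v)) (L (u, a, v)) v))"
    unfolding E by (rule card_UN_le) (use sub fin finite_subset in blast)
  also have "\<dots> \<le> (\<Sum>e\<in>edges D'. k)"
  proof (rule sum_mono, clarify)
    fix u a v assume "(u, a, v) \<in> edges D'"
    then show "card (path_edges u (I (u, a, v)) (L (u, a, v)) v) \<le> k"
      using I[of "(u, a, v)"] card_path_edges_le[of "L (u, a, v)" "I (u, a, v)" u v] by simp
  qed
  also have "\<dots> \<le> card (verts D' \<times> \<Sigma> \<times> verts D') * k"
    using card_mono[OF fin sub] by simp
  finally show ?thesis by (simp add: card_cartesian_product mult.assoc)
qed

section \<open>The merged graph and its paths\<close>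

text \<open>
  A vertex \<open>j = v + n * c\<close> with \<open>v < n\<close> stands for having to read the word with code \<open>c\<close> on the way to
  the ordinary vertex \<open>v\<close>. All codes up to some bound are present, whether or not they arise from
  the subdivision-graph, so that the edges leaving these vertices can be listed arithmetically and
  only the edges leaving ordinary vertices have to be checked for duplicates.
\<close>

definition word_edge :: "nat \<Rightarrow> nat \<Rightarrow> nat \<Rightarrow> nat \<times> nat \<times> nat" where
  "word_edge \<sigma> n j = (j, (j div n - 1) mod \<sigma>, j mod n + n * ((j div n - 1) div \<sigma>))"

locale numbered_subdivided_graph =
  subdivided_graph "{..<V}" "{..<n}" E "{..<\<sigma>}" K tgt word
  for V n :: nat and E and \<sigma> K :: nat and tgt word +
  assumes n_pos: "0 < n" and n_le: "n \<le> V"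
begin

definition merge :: "nat \<Rightarrow> nat" where
  "merge x = tgt x + n * word_code \<sigma> (word x)"

definition merged_graph :: "nat \<Rightarrow> (nat, nat) lgraph" where
  "merged_graph N = \<lparr>verts = {..<N},
     edges = (\<lambda>(u, a, y). (u, a, merge y)) ` {(u, a, y) \<in> E. u < n} \<union> word_edge \<sigma> n ` {n..<N}\<rparr>"

lemma E_bounds: "(x, a, y) \<in> E \<Longrightarrow> x < V \<and> a < \<sigma> \<and> y < V"
  using edges by auto

lemma merge_ordinary: "x < n \<Longrightarrow> merge x = x"
  by (simp add: merge_def tgt_ordinary word_ordinary)

lemma tgt_less: "x < V \<Longrightarrow> tgt x < n"
  using word_tgt_closed[of x] by simp

text \<open>The word of an additional vertex is nonempty and so has a positive code. Hence no
  additional vertex is identified with an ordinary one.\<close>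

lemma merge_additional:
  assumes "x < V" "n \<le> x"
  shows "n \<le> merge x"
proof -
  obtain a y where "(x, a, y) \<in> E"
    using out_edge[of x] assms by auto
  then have "word x = a # word y"
    using word_additional assms by simp
  then have "n * 1 \<le> n * word_code \<sigma> (word x)"
    by (intro mult_le_mono2) simp
  then show ?thesis
    unfolding merge_def mult_1_right by (rule trans_le_add2)
qed

text \<open>The first letter is the least significant digit. Division by \<open>n\<close> separates
  code and target; lowering the code by 1 undoes the shift of the digits to 1, ..., \<sigma>, and
  division by \<sigma> then splits off the first letter.\<close>

lemma word_edge_merge:
  assumes "(x, a, y) \<in> E" "n \<le> x"
  shows "word_edge \<sigma> n (merge x) = (merge x, a, merge y)"
proof -
  define c where "c = \<sigma> * word_code \<sigma> (word y) + a + 1"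
  have bounds: "tgt y < n" "a < \<sigma>"
    using E_bounds[OF assms(1)] tgt_less by auto
  have merge_eq: "merge x = tgt y + n * c"
    using assms word_additional[OF assms(1)] tgt_additional[OF assms(1)] by (simp add: merge_def c_def)
  then have "merge x div n = c" "merge x mod n = tgt y"
    using n_pos bounds by simp_all
  moreover have "(c - 1) mod \<sigma> = a" "(c - 1) div \<sigma> = word_code \<sigma> (word y)"
    using bounds by (simp_all add: c_def)
  ultimately show ?thesis
    by (simp add: word_edge_def merge_def)
qed

lemma word_code_word_less:
  assumes "x < V"
  shows "word_code \<sigma> (word x) < (\<sigma> + 1) ^ K"
proof -
  have "word_code \<sigma> (word x) < (\<sigma> + 1) ^ length (word x)"
    using word_tgt_closed assms by (intro word_code_less) auto
  also have "\<dots> \<le> (\<sigma> + 1) ^ K"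
    using length_word assms by (intro power_increasing) auto
  finally show ?thesis .
qed

text \<open>The program settles on \<open>N\<close> only at run time, so any \<open>N\<close> above
  all values of \<open>merge\<close> is allowed. Vertices beyond the ordinary ones need a terminal
  for their edges, since \<open>b mod 0\<close> is \<open>b\<close>; hence
  \<open>\<sigma>_pos\<close>.\<close>

context
  fixes N :: nat
  assumes N_ge: "n \<le> N" and merge_less: "x < V \<Longrightarrow> merge x < N" and \<sigma>_pos: "n < N \<Longrightarrow> 0 < \<sigma>"
begin

lemma wf_merged_graph: "wf_lgraph {..<\<sigma>} (merged_graph N)"
proof -
  have "j mod n + n * ((j div n - 1) div \<sigma>) < N" if "n \<le> j" "j < N" for j
  proof -
    have "j div n \<ge> 1" using that n_pos by (simp add: Suc_le_eq div_greater_zero_iff)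
    \<comment> \<open>Removing a digit does not increase the code, so the edge leaving
      \<open>j\<close> ends at or below \<open>j\<close>.\<close>
    then have "(j div n - 1) div \<sigma> \<le> j div n" by (meson diff_le_self div_le_dividend le_trans)
    then have "n * ((j div n - 1) div \<sigma>) \<le> n * (j div n)" by simp
    then have "j mod n + n * ((j div n - 1) div \<sigma>) \<le> j"
      using mod_mult_div_eq[of j n] by linarith
    then show ?thesis using that by simp
  qed
  moreover have "merge y < N" "u < N" "a < \<sigma>" if "(u, a, y) \<in> E" "u < n" for u a y
    using E_bounds[OF that(1)] merge_less that N_ge by auto
  moreover have "b mod \<sigma> < \<sigma>" if "n \<le> j" "j < N" for j b
    using \<sigma>_pos that by simp
  ultimately show ?thesis
    using n_pos N_ge by (auto simp: wf_lgraph_def merged_graph_def word_edge_def lessThan_empty_iff)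
qed

lemma merged_edge:
  assumes "(x, a, y) \<in> E"
  shows "(merge x, a, merge y) \<in> edges (merged_graph N)"
proof (cases "x < n")
  case True
  then show ?thesis
    using assms
    by (auto simp: merged_graph_def merge_ordinary intro!: image_eqI[of _ _ "(x, a, y)"])
next
  case False
  then have "(merge x, a, merge y) \<in> word_edge \<sigma> n ` {n..<N}"
    using word_edge_merge[OF assms] merge_additional merge_less E_bounds[OF assms]
    by (intro image_eqI[of _ _ "merge x"]) auto
  then show ?thesis by (simp add: merged_graph_def)
qed

text \<open>With \<open>merged_edge\<close> this makes \<open>merge\<close> a functional
  bisimulation. An edge lifts to every vertex \<open>x\<close> of the merged class: an ordinary
  vertex is alone in its class, and a vertex from \<open>n\<close> on has a single outgoing
  edge.\<close>

lemma merged_edge_lift: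
  assumes "(merge x, a, z) \<in> edges (merged_graph N)" "x < V"
  shows "\<exists>y. (x, a, y) \<in> E \<and> z = merge y"
proof (cases "x < n")
  case True
  with assms show ?thesis
    by (auto simp: merged_graph_def merge_ordinary word_edge_def)
next
  case False
  then obtain b y where y: "(x, b, y) \<in> E" using out_edge[of x] assms by auto
  moreover have "(merge x, a, z) = word_edge \<sigma> n (merge x)"
    using assms False merge_additional[of x] by (auto simp: merged_graph_def word_edge_def)
  ultimately show ?thesis
    using word_edge_merge[OF y] False by auto
qed

lemma merged_path:
  assumes "labelled_path D x w y" "verts D = {..<V}" "edges D = E"
  shows "labelled_path (merged_graph N) (merge x) w (merge y)"
  using assms(1)
proof (induction rule: labelled_path.induct)
  case (empty u)
  then show ?case
    using merge_less assms by (intro labelled_path.empty) (simp add: merged_graph_def)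
next
  case (edge u a x w v)
  then show ?case
    using merged_edge assms by (intro labelled_path.edge) auto
qed

lemma merged_path_lift:
  assumes "labelled_path (merged_graph N) j w z" "j = merge x" "x < V"
    and D: "verts D = {..<V}" "edges D = E"
  shows "\<exists>y. labelled_path D x w y \<and> y < V \<and> z = merge y"
  using assms(1-3)
proof (induction arbitrary: x rule: labelled_path.induct)
  case (empty u)
  then show ?case
    using labelled_path.empty[of x D] D by auto
next
  case (edge u a j w v)
  then obtain x' where x': "(x, a, x') \<in> E" "j = merge x'"
    using merged_edge_lift by blast
  with edge.IH[of x'] E_bounds[OF x'(1)] show ?case
    using labelled_path.edge D by fastforce
qed

lemma S_path_exists_merged:
  assumes "verts D = {..<V}" "edges D = E" "u < n" "v < n"
  shows "S_path_exists G (merged_graph N) u v \<longleftrightarrow> S_path_exists G D u v"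
proof -
  have "labelled_path (merged_graph N) u w v \<longleftrightarrow> labelled_path D u w v" for w
  proof
    assume "labelled_path (merged_graph N) u w v"
    then obtain y where y: "labelled_path D u w y" "y < V" "v = merge y"
      using merged_path_lift[of u w v u D] merge_ordinary assms n_le by auto
    \<comment> \<open>Lifting determines the end of the path only up to \<open>merge\<close>, but no
      additional vertex is merged into the ordinary vertex \<open>v\<close>.\<close>
    then have "y < n"
      using merge_additional[of y] assms(4) by (cases "y < n") auto
    then show "labelled_path D u w v"
      using y merge_ordinary by simp
  next
    assume "labelled_path D u w v"
    then show "labelled_path (merged_graph N) u w v"
      using merged_path[of D u w v] assms merge_ordinary by simp
  qed
  then show ?thesis by (simp add: S_path_exists_def)
qed

end

end

section \<open>The program\<close>

abbreviation (input) "var_n \<equiv> 2::nat"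
abbreviation (input) "var_e \<equiv> 3::nat"
abbreviation (input) "var_i \<equiv> 4::nat"
abbreviation (input) "var_u \<equiv> 5::nat"
abbreviation (input) "var_a \<equiv> 6::nat"
abbreviation (input) "var_y \<equiv> 7::nat"
abbreviation (input) "var_c \<equiv> 8::nat"
abbreviation (input) "var_w \<equiv> 9::nat"
abbreviation (input) "var_max \<equiv> 10::nat"
abbreviation (input) "var_pos \<equiv> 11::nat"
abbreviation (input) "var_N \<equiv> 12::nat"
abbreviation (input) "var_z \<equiv> 13::nat"
text \<open>
  The given program is run with array 0 renamed to \<open>arr_instance\<close>, hence with its output, array 1,
  in \<open>arr_result\<close>.
\<close>

abbreviation (input) "arr_label \<equiv> 2::nat"
abbreviation (input) "arr_target \<equiv> 3::nat"
abbreviation (input) "arr_seen \<equiv> 4::nat"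
abbreviation (input) "arr_instance \<equiv> 5::nat"
abbreviation (input) "arr_result \<equiv> 6::nat"

abbreviation (input) "first_free_var \<equiv> 14::nat"

fun seq :: "com list \<Rightarrow> com" where
  "seq [] = Skip"
| "seq [p] = p"
| "seq (p # ps) = Seq p (seq ps)"

text \<open>The header of the input has three entries, so the source, label and target of an edge
  are obtained with \<open>r\<close> = 3, 4 and 5.\<close>

definition edge_entry :: "nat \<Rightarrow> expr" where
  "edge_entry r = Read 0 (Bin Plus (Bin Times (Lit 3) (Var var_i)) (Lit r))"

definition load_edge :: com where
  "load_edge = seq [Assign var_u (edge_entry 3), Assign var_a (edge_entry 4), Assign var_y (edge_entry 5)]"

definition increment :: com where
  "increment = Assign var_i (Bin Plus (Var var_i) (Lit 1))"

text \<open>Ordinary vertices may have many outgoing edges, which overwrite each other's entries.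
  Only the entries of additional vertices, with their single outgoing edge, are read later.\<close>

definition scan_edges :: com where
  "scan_edges = seq
     [Assign var_n (Read 0 (Lit 0)), Assign var_e (Read 0 (Lit 2)), Assign var_i (Lit 0),
      While (Bin Less (Var var_i) (Var var_e)) (seq
        [load_edge,
         Write arr_label (Var var_u) (Var var_a),
         Write arr_target (Var var_u) (Var var_y),
         increment])]"

text \<open>The word is met from its least significant letter on, so the weight of a letter is maintained in \<open>var_w\<close>.\<close>

definition walk_loop :: "nat \<Rightarrow> com" where
  "walk_loop \<sigma> = While (Bin Less (Var var_n) (Bin Plus (Var var_y) (Lit 1))) (seq
     [Assign var_c (Bin Plus (Var var_c) (Bin Times (Var var_w) (Bin Plus (Read arr_label (Var var_y)) (Lit 1)))),
      Assign var_w (Bin Times (Var var_w) (Lit \<sigma>)),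
      Assign var_y (Read arr_target (Var var_y))])"

definition walk :: "nat \<Rightarrow> com" where
  "walk \<sigma> = seq [Assign var_c (Lit 0), Assign var_w (Lit 1), walk_loop \<sigma>]"

definition emit :: "expr \<Rightarrow> expr \<Rightarrow> expr \<Rightarrow> com" where
  "emit e1 e2 e3 = seq
     [Write arr_instance (Var var_pos) e1,
      Write arr_instance (Bin Plus (Var var_pos) (Lit 1)) e2,
      Write arr_instance (Bin Plus (Var var_pos) (Lit 2)) e3,
      Assign var_pos (Bin Plus (Var var_pos) (Lit 3))]"

text \<open>Merging targets can make edges of an ordinary vertex coincide, while the given program
  expects a list without repetitions. As arrays start out zero, a table over all possible triples
  needs no initialisation.\<close>

definition emit_ordinary :: "nat \<Rightarrow> com" where
  "emit_ordinary \<sigma> = seq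
     [Assign var_y (Bin Plus (Var var_y) (Bin Times (Var var_n) (Var var_c))),
      Assign var_z (Bin Plus (Bin Times (Bin Plus (Bin Times (Var var_y) (Var var_n)) (Var var_u)) (Lit \<sigma>))
        (Var var_a)),
      Cond (Read arr_seen (Var var_z)) Skip
        (Seq (Write arr_seen (Var var_z) (Lit 1)) (emit (Var var_u) (Var var_a) (Var var_y)))]"

text \<open>The instance is filled from position \<open>h\<close> on, behind a header that can be
  written only once the numbers of vertices and edges are known. Every additional vertex is the
  target of some edge, so the maximum bounds all codes without reference to
  \<open>k\<close>.\<close>

definition merge_edges :: "nat \<Rightarrow> nat \<Rightarrow> com" where
  "merge_edges \<sigma> h = seq
     [Assign var_i (Lit 0), Assign var_max (Lit 0), Assign var_pos (Lit h),
      While (Bin Less (Var var_i) (Var var_e)) (seq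
        [load_edge, walk \<sigma>,
         Cond (Bin Less (Var var_max) (Var var_c)) (Assign var_max (Var var_c)) Skip,
         Cond (Bin Less (Var var_u) (Var var_n)) (emit_ordinary \<sigma>) Skip,
         increment])]"

definition word_edges :: "nat \<Rightarrow> com" where
  "word_edges \<sigma> = seq
     [Assign var_N (Bin Times (Var var_n) (Bin Plus (Var var_max) (Lit 1))),
      Assign var_i (Var var_n),
      While (Bin Less (Var var_i) (Var var_N)) (seq
        [Assign var_c (Bin Minus (Bin Div (Var var_i) (Var var_n)) (Lit 1)),
         emit (Var var_i) (Bin Mod (Var var_c) (Lit \<sigma>))
           (Bin Plus (Bin Mod (Var var_i) (Var var_n)) (Bin Times (Var var_n) (Bin Div (Var var_c) (Lit \<sigma>)))),
         increment])]"

text \<open>Unrolled rather than a loop: for a fixed grammar the header of an instance has constant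
  length.\<close>

fun write_list :: "nat \<Rightarrow> expr list \<Rightarrow> com" where
  "write_list i [] = Skip"
| "write_list i (e # es) = Seq (Write arr_instance (Lit i) e) (write_list (Suc i) es)"

text \<open>An edge takes three entries from \<open>h\<close> on, so the number of edges can be read
  off the final position.\<close>

definition write_header :: "(nat, nat) cfg \<Rightarrow> (nat \<times> (nat, nat) sym list) list \<Rightarrow> nat \<Rightarrow> com" where
  "write_header G ps h = Seq
     (Assign var_z (Bin Div (Bin Minus (Var var_pos) (Lit h)) (Lit 3)))
     (write_list 0
       ([Var var_N, Lit (card (nonterms G)), Lit (card (terms G)), Lit (start G), Lit (length ps), Var var_z]
         @ map Lit (concat (map encode_prod ps))))"

text \<open>The given program leaves a matrix with rows of length \<open>N\<close>, the answer has
  rows of length \<open>n\<close>. One counter, split by \<open>div\<close> and \<open>mod\<close>,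
  replaces a nested loop.\<close>

definition copy_output :: com where
  "copy_output = seq
     [Assign var_i (Lit 0),
      While (Bin Less (Var var_i) (Bin Times (Var var_n) (Var var_n))) (seq
        [Write 1 (Var var_i) (Read arr_result
           (Bin Plus (Bin Times (Bin Div (Var var_i) (Var var_n)) (Var var_N)) (Bin Mod (Var var_i) (Var var_n)))),
         increment])]"

definition reduction :: "(nat, nat) cfg \<Rightarrow> (nat \<times> (nat, nat) sym list) list \<Rightarrow> com \<Rightarrow> com" where
  "reduction G ps p = (let \<sigma> = card (terms G); h = 6 + length (concat (map encode_prod ps)) in seq
     [scan_edges, merge_edges \<sigma> h, word_edges \<sigma>, write_header G ps h,
      shift_com first_free_var arr_instance p, copy_output])"

section \<open>Correctness of the program\<close>

text \<open>The value 0 outside the list is the initial content of an array, so whole arrays can be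
  compared as functions.\<close>

definition segment :: "nat \<Rightarrow> nat list \<Rightarrow> nat \<Rightarrow> nat" where
  "segment h L i = (if h \<le> i \<and> i < h + length L then L ! (i - h) else 0)"

lemma segment_Nil: "segment h [] = (\<lambda>_. 0)"
  by (simp add: segment_def fun_eq_iff)

lemma segment_snoc: "(segment h L)(h + length L := x) = segment h (L @ [x])"
  by (auto simp: segment_def fun_eq_iff nth_append)

lemma segment_snoc3:
  assumes "p = h + length L"
  shows "(segment h L)(p := a, Suc p := b, Suc (Suc p) := c) = segment h (L @ [a, b, c])"
  using segment_snoc[of h L a] segment_snoc[of h "L @ [a]" b] segment_snoc[of h "L @ [a, b]" c] assms
  by simp

lemma length_concat_encode_edge [simp]: "length (concat (map encode_edge es)) = 3 * length es"
  by (induction es) auto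

lemma concat_encode_edge_nth:
  assumes "i < length es"
  shows "concat (map encode_edge es) ! (3 * i) = fst (es ! i)"
    and "concat (map encode_edge es) ! (3 * i + 1) = fst (snd (es ! i))"
    and "concat (map encode_edge es) ! (3 * i + 2) = snd (snd (es ! i))"
  using assms
proof (induction es arbitrary: i)
  case (Cons e es)
  {
    case 1 then show ?case using Cons.IH(1) by (cases e; cases i) auto
  next
    case 2 then show ?case using Cons.IH(2) by (cases e; cases i) auto
  next
    case 3 then show ?case using Cons.IH(3) by (cases e; cases i) auto
  }
qed simp_all

section \<open>Invariants and word bounds\<close>

definition holds_input :: "nat \<Rightarrow> (nat \<times> nat \<times> nat) list \<Rightarrow> (nat \<Rightarrow> nat) \<Rightarrow> bool" where
  "holds_input n es f \<longleftrightarrow> f 0 = n \<and> f 2 = length es \<and>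
     (\<forall>i<length es. f (3 * i + 3) = fst (es ! i) \<and> f (3 * i + 4) = fst (snd (es ! i)) \<and>
        f (3 * i + 5) = snd (snd (es ! i)))"

lemma holds_input_input_state:
  "holds_input n es (arrs (input_state (encode_subdivision n m es)) 0)"
proof -
  have "(encode_subdivision n m es) ! (3 * i + 3) = fst (es ! i)"
    "(encode_subdivision n m es) ! (3 * i + 4) = fst (snd (es ! i))"
    "(encode_subdivision n m es) ! (3 * i + 5) = snd (snd (es ! i))" if "i < length es" for i
    using concat_encode_edge_nth[OF that] by (simp_all add: encode_subdivision_def eval_nat_numeral)
  then show ?thesis
    by (auto simp: holds_input_def input_state_def) (simp_all add: encode_subdivision_def)
qed

text \<open>What the renamed program has to find when it starts: its variables, and its arrays other
  than the input, are still 0.\<close>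

definition untouched :: "(nat \<Rightarrow> nat) \<Rightarrow> (nat \<Rightarrow> nat \<Rightarrow> nat) \<Rightarrow> bool" where
  "untouched f g \<longleftrightarrow> (\<forall>x\<ge>first_free_var. f x = 0) \<and> (\<forall>a\<ge>arr_result. g a = (\<lambda>_. 0))"

lemma untouched_update [simp]:
  "x < first_free_var \<Longrightarrow> untouched (f(x := v)) g \<longleftrightarrow> untouched f g"
  "a < arr_result \<Longrightarrow> untouched f (g(a := l)) \<longleftrightarrow> untouched f g"
  by (auto simp: untouched_def)

text \<open>The bounds on \<open>B\<close> cover the largest values that occur:
  \<open>B_matrix\<close> the index into the matrix with rows of length \<open>N\<close>,
  \<open>B_code\<close> codes and weights during a walk, \<open>B_seen\<close> the index into the
  table of emitted edges, \<open>B_pos\<close> the position in the instance.\<close>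

locale merging = numbered_subdivided_graph V n E \<sigma> K tgt word
  for V n :: nat and E and \<sigma> K :: nat and tgt word +
  fixes es :: "(nat \<times> nat \<times> nat) list" and B h :: nat
  assumes es: "enumerates es E"
    and B_n: "n * (n + 1) + 10 \<le> B"
    and B_matrix: "n * (n * (\<sigma> + 1) ^ K) + n \<le> B"
    and B_es: "3 * length es + 10 \<le> B"
    and B_V: "V \<le> B"
    and B_code: "(\<sigma> + 1) ^ K + \<sigma> + 1 \<le> B"
    and B_seen: "((n * (\<sigma> + 1) ^ K) * n + n) * \<sigma> + \<sigma> \<le> B"
    and B_pos: "h + 3 * (length es + n * (\<sigma> + 1) ^ K) + 10 \<le> B"
begin

lemma set_es: "set es = E"
  using es by (auto simp: enumerates_def)

definition env :: "(nat \<Rightarrow> nat) \<Rightarrow> (nat \<Rightarrow> nat \<Rightarrow> nat) \<Rightarrow> bool" where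
  "env f g \<longleftrightarrow> f var_n = n \<and> f var_e = length es \<and> holds_input n es (g 0) \<and> untouched f g"

definition scanned :: "nat \<Rightarrow> (nat \<Rightarrow> nat \<Rightarrow> nat) \<Rightarrow> bool" where
  "scanned i g \<longleftrightarrow> (\<forall>(x, a, y) \<in> set (take i es). n \<le> x \<longrightarrow> g arr_label x = a \<and> g arr_target x = y)"

lemma es_nthD:
  assumes "i < length es" "es ! i = (u, a, y)"
  shows "(u, a, y) \<in> E" "u < V" "a < \<sigma>" "y < V" "u \<le> B" "a \<le> B" "y + 1 \<le> B"
proof -
  show E: "(u, a, y) \<in> E" using assms set_es nth_mem by metis
  from E_bounds[OF E] show "u < V" "a < \<sigma>" "y < V" by auto
  then show "u \<le> B" "a \<le> B" "y + 1 \<le> B" using B_V B_code by auto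
qed

section \<open>The phases of the reduction\<close>

lemma wp_load_edge:
  assumes "env (vars s) (arrs s)" "vars s var_i = i" "i < length es" "es ! i = (u, a, y)"
  shows "wp B load_edge s Q \<longleftrightarrow>
    Q 21 (s\<lparr>vars := (vars s)(var_u := u, var_a := a, var_y := y)\<rparr>)"
proof -
  have "arrs s 0 (3 * i + 3) = u" "arrs s 0 (3 * i + 4) = a" "arrs s 0 (3 * i + 5) = y"
    using assms by (auto simp: env_def holds_input_def)
  then show ?thesis
    using assms es_nthD[OF assms(3,4)] B_es
    by (simp add: load_edge_def edge_entry_def eval_nat_numeral)
qed

lemma scan_edges:
  assumes "holds_input n es (arrs s 0)" "untouched (vars s) (arrs s)"
    and "arrs s arr_seen = (\<lambda>_. 0)" "arrs s arr_instance = (\<lambda>_. 0)"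
  shows "wp B scan_edges s (\<lambda>t s'. t \<le> 40 * (length es + 1) \<and> env (vars s') (arrs s') \<and>
    scanned (length es) (arrs s') \<and> arrs s' arr_seen = (\<lambda>_. 0) \<and> arrs s' arr_instance = (\<lambda>_. 0))"
proof -
  define I where "I i s' \<longleftrightarrow> env (vars s') (arrs s') \<and> vars s' var_i = i \<and> scanned i (arrs s') \<and>
     arrs s' arr_seen = (\<lambda>_. 0) \<and> arrs s' arr_instance = (\<lambda>_. 0)" for i and s' :: state
  let ?e = "Bin Less (Var var_i) (Var var_e)"
  let ?body = "seq [load_edge, Write arr_label (Var var_u) (Var var_a),
    Write arr_target (Var var_u) (Var var_y), increment]"
  have loop: "wp B (While ?e ?body) s' (\<lambda>t s''. t \<le> (length es - 0) * (1 + expr_time ?e + 31) + (1 + expr_time ?e)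
      \<and> I (length es) s'')" if "I 0 s'" for s'
  proof (rule wp_While_upto)
    fix i s' assume i: "i < length es" and I: "I i s'"
    obtain u a y where e: "es ! i = (u, a, y)" by (cases "es ! i")
    have env: "env (vars s') (arrs s')" "vars s' var_i = i" using I by (auto simp: I_def)
    have scanned: "scanned (Suc i) ((arrs s')(arr_label := (arrs s' arr_label)(u := a),
        arr_target := (arrs s' arr_target)(u := y)))"
    proof -
      \<comment> \<open>Edges leaving the same additional vertex are equal, so this write cannot
        spoil an earlier entry.\<close>
      have "b = a \<and> z = y" if "(u, b, z) \<in> set (take i es)" "n \<le> u" for b z
      proof -
        have "(u, b, z) \<in> E"
          using that(1) set_es in_set_takeD[of "(u, b, z)" i es] by simp
        from out_edge_unique[OF this es_nthD(1)[OF i e]] that(2) show ?thesis by simp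
      qed
      then show ?thesis
        using I e i by (auto simp: I_def scanned_def take_Suc_conv_app_nth)
    qed
    show "expr_fits B s' ?e \<and> expr_val s' ?e \<noteq> 0 \<and> wp B ?body s' (\<lambda>t s''. t \<le> 31 \<and> I (Suc i) s'')"
      using env i B_es es_nthD[OF i e] I scanned
      by (simp add: wp_load_edge[OF env i e] I_def increment_def) (simp add: env_def)
  next
    fix s' assume "I (length es) s'"
    then show "expr_fits B s' ?e \<and> expr_val s' ?e = 0"
      using B_es by (simp add: I_def env_def)
  qed (use that in auto)
  have n: "arrs s 0 0 = n" "arrs s 0 2 = length es"
    using assms by (auto simp: holds_input_def)
  let ?s' = "s\<lparr>vars := (vars s)(var_n := n, var_e := length es, var_i := 0)\<rparr>"
  have "I 0 ?s'"
    using assms by (simp add: I_def env_def scanned_def)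
  from loop[OF this]
  have "wp B (While ?e ?body) ?s' (\<lambda>t s''. 8 + t \<le> 40 * (length es + 1) \<and> I (length es) s'')"
    by (rule wp_mono) auto
  then show ?thesis
    using n B_n B_es by (auto simp: scan_edges_def I_def add.assoc elim!: wp_mono)
qed

text \<open>A pass preserves two quantities: the code so far plus the weight times the code of the
  rest, and the weight times \<sigma> to the length of the rest. So the bounds by \<open>B\<close>
  persist, and at the ordinary vertex, where the rest is empty, the first quantity is the result.
  The number of passes is the length of the word, hence the induction on it.\<close>

lemma walk_loop:
  assumes "scanned (length es) (arrs s)" "vars s var_n = n" "vars s var_y = y" "y < V"
    and "vars s var_c + vars s var_w * word_code \<sigma> (word y) \<le> B"
    and "vars s var_w * \<sigma> ^ length (word y) \<le> B"
  shows "wp B (walk_loop \<sigma>) s (\<lambda>t s'. t \<le> 30 * length (word y) + 6 \<and>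
    (\<exists>w. s' = s\<lparr>vars := (vars s)(var_c := vars s var_c + vars s var_w * word_code \<sigma> (word y),
      var_w := w, var_y := tgt y)\<rparr>))"
  using assms
proof (induction "length (word y)" arbitrary: y s)
  case 0
  then have "word y = []" by simp
  then have "y < n"
    using out_edge[of y] word_additional[of y] 0 by fastforce
  have "s = s\<lparr>vars := (vars s)(var_c := vars s var_c + vars s var_w * word_code \<sigma> (word y),
      var_w := vars s var_w, var_y := tgt y)\<rparr>"
    using \<open>y < n\<close> \<open>word y = []\<close> by (simp add: tgt_ordinary flip: 0(4))
  with \<open>y < n\<close> show ?case
    using 0(3,4) B_n \<open>word y = []\<close> unfolding walk_loop_def
    by (intro wp_While_False conjI exI) (assumption | simp)+
next
  case (Suc l)
  then have "n \<le> y" using word_ordinary[of y] by fastforce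
  then obtain a z where z: "(y, a, z) \<in> E" using out_edge[of y] Suc by auto
  then have word: "word y = a # word z" and tgt: "tgt y = tgt z"
    using \<open>n \<le> y\<close> word_additional tgt_additional by auto
  have bounds: "y < V" "z < V" "a < \<sigma>" using E_bounds[OF z] by auto
  have arr: "arrs s arr_label y = a" "arrs s arr_target y = z"
    using z \<open>n \<le> y\<close> Suc(3) set_es by (auto simp: scanned_def)
  let ?c = "vars s var_c" and ?w = "vars s var_w"
  let ?s' = "s\<lparr>vars := (vars s)(var_c := ?c + ?w * (a + 1), var_w := ?w * \<sigma>, var_y := z)\<rparr>"
  have code: "?c + ?w * (a + 1) + ?w * \<sigma> * word_code \<sigma> (word z) = ?c + ?w * word_code \<sigma> (word y)"
    by (simp add: word algebra_simps)
  have power: "?w * \<sigma> * \<sigma> ^ length (word z) = ?w * \<sigma> ^ length (word y)"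
    by (simp add: word)
  have IH: "wp B (walk_loop \<sigma>) ?s' (\<lambda>t s'. t \<le> 30 * length (word z) + 6 \<and>
    (\<exists>w. s' = ?s'\<lparr>vars := (vars ?s')(var_c := vars ?s' var_c + vars ?s' var_w * word_code \<sigma> (word z),
      var_w := w, var_y := tgt z)\<rparr>))"
    using Suc code power by (intro Suc.hyps(1)) (simp_all add: word bounds)
  have w: "?w * \<sigma> \<le> B"
  proof -
    have "?w * \<sigma> * 1 \<le> ?w * \<sigma> * \<sigma> ^ length (word z)"
      using bounds by (intro mult_le_mono2) simp
    then show ?thesis using power Suc.prems(6) by linarith
  qed
  have c: "?c + ?w * (a + 1) \<le> B"
    using code Suc.prems(5) by linarith
  have "wp B (walk_loop \<sigma>) ?s' (\<lambda>t s'. 22 + t \<le> 30 * length (word y) + 6 \<and>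
    (\<exists>w. s' = s\<lparr>vars := (vars s)(var_c := ?c + ?w * word_code \<sigma> (word y),
      var_w := w, var_y := tgt y)\<rparr>))"
    using IH
  proof (rule wp_mono, elim conjE exE, intro conjI)
    fix t s' w'
    assume "t \<le> 30 * length (word z) + 6"
    then show "22 + t \<le> 30 * length (word y) + 6" by (simp add: word)
    assume "s' = ?s'\<lparr>vars := (vars ?s')(var_c := vars ?s' var_c + vars ?s' var_w * word_code \<sigma> (word z),
      var_w := w', var_y := tgt z)\<rparr>"
    then show "\<exists>w. s' = s\<lparr>vars := (vars s)(var_c := ?c + ?w * word_code \<sigma> (word y),
      var_w := w, var_y := tgt y)\<rparr>"
      using code tgt by (intro exI[of _ w']) (simp add: fun_upd_twist add.assoc)
  qed
  then show ?case
    using Suc(3-6) bounds arr w c \<open>n \<le> y\<close> B_V B_code B_n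
    unfolding walk_loop_def
    by (intro wp_While_True) (auto simp: add.assoc elim!: wp_mono)
qed

lemma walk:
  assumes "scanned (length es) (arrs s)" "vars s var_n = n" "vars s var_y = y" "y < V"
  shows "wp B (walk \<sigma>) s (\<lambda>t s'. t \<le> 30 * K + 10 \<and>
    (\<exists>w. s' = s\<lparr>vars := (vars s)(var_c := word_code \<sigma> (word y), var_w := w, var_y := tgt y)\<rparr>))"
proof -
  let ?s' = "s\<lparr>vars := (vars s)(var_c := 0, var_w := 1)\<rparr>"
  have len: "length (word y) \<le> K" using length_word assms by simp
  have "\<sigma> ^ length (word y) \<le> (\<sigma> + 1) ^ length (word y)"
    by (rule power_mono) auto
  also have "\<dots> \<le> (\<sigma> + 1) ^ K"
    using len by (intro power_increasing) auto
  finally have "\<sigma> ^ length (word y) \<le> B" using B_code by simp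
  then have "wp B (walk_loop \<sigma>) ?s' (\<lambda>t s'. t \<le> 30 * length (word y) + 6 \<and>
    (\<exists>w. s' = ?s'\<lparr>vars := (vars ?s')(var_c := vars ?s' var_c + vars ?s' var_w * word_code \<sigma> (word y),
      var_w := w, var_y := tgt y)\<rparr>))"
    using assms word_code_word_less[OF assms(4)] B_code by (intro walk_loop) auto
  then have "wp B (walk_loop \<sigma>) ?s' (\<lambda>t s'. 4 + t \<le> 30 * K + 10 \<and>
    (\<exists>w. s' = s\<lparr>vars := (vars s)(var_c := word_code \<sigma> (word y), var_w := w, var_y := tgt y)\<rparr>))"
  proof (rule wp_mono, elim conjE exE, intro conjI)
    fix t s' w
    assume "t \<le> 30 * length (word y) + 6"
    then show "4 + t \<le> 30 * K + 10" using len by simp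
    assume "s' = ?s'\<lparr>vars := (vars ?s')(var_c := vars ?s' var_c + vars ?s' var_w * word_code \<sigma> (word y),
      var_w := w, var_y := tgt y)\<rparr>"
    then show "\<exists>w. s' = s\<lparr>vars := (vars s)(var_c := word_code \<sigma> (word y), var_w := w, var_y := tgt y)\<rparr>"
      by (intro exI[of _ w]) (simp add: fun_upd_twist)
  qed
  then show ?thesis
    using B_n by (simp add: walk_def)
qed

lemma env_cong:
  assumes "env f g" "\<And>v. v < var_i \<or> first_free_var \<le> v \<Longrightarrow> f' v = f v"
    and "\<And>b. b = 0 \<or> arr_result \<le> b \<Longrightarrow> g' b = g b"
  shows "env f' g'"
  using assms by (auto simp: env_def untouched_def)

text \<open>The target is the leading digit, so injectivity requires ranges for source and label
  only.\<close>

definition key :: "nat \<times> nat \<times> nat \<Rightarrow> nat" where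
  "key = (\<lambda>(u, a, x). (x * n + u) * \<sigma> + a)"

lemma key_inj: "u < n \<Longrightarrow> a < \<sigma> \<Longrightarrow> u' < n \<Longrightarrow> a' < \<sigma> \<Longrightarrow> key (u, a, x) = key (u', a', x') \<Longrightarrow>
    u = u' \<and> a = a' \<and> x = x'"
proof -
  assume *: "u < n" "a < \<sigma>" "u' < n" "a' < \<sigma>" "key (u, a, x) = key (u', a', x')"
  have div: "key (u, a, x) div \<sigma> = x * n + u" "key (u, a, x) mod \<sigma> = a"
    if "a < \<sigma>" for u a x
    using that by (simp_all add: key_def)
  have "a = a'" "x * n + u = x' * n + u'"
    using * div[of a u x] div[of a' u' x'] by simp_all
  moreover have "(x * n + u) div n = x" "(x * n + u) mod n = u" if "u < n" for x u
    using that by simp_all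
  ultimately show "u = u' \<and> a = a' \<and> x = x'" using * by metis
qed

definition emitted :: "(nat \<times> nat \<times> nat) list \<Rightarrow> (nat \<Rightarrow> nat) \<Rightarrow> (nat \<Rightarrow> nat \<Rightarrow> nat) \<Rightarrow> bool" where
  "emitted out f g \<longleftrightarrow> distinct out \<and> f var_pos = h + 3 * length out \<and>
     g arr_instance = segment h (concat (map encode_edge out))"

definition marked :: "(nat \<times> nat \<times> nat) set \<Rightarrow> (nat \<Rightarrow> nat \<Rightarrow> nat) \<Rightarrow> bool" where
  "marked X g \<longleftrightarrow> X \<subseteq> {..<n} \<times> {..<\<sigma>} \<times> UNIV \<and> g arr_seen = (\<lambda>z. if z \<in> key ` X then 1 else 0)"

lemma emit_ordinary:
  assumes vars: "vars s var_n = n" "vars s var_u = u" "vars s var_a = a" "vars s var_y = t" "vars s var_c = c"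
    and x: "x = t + n * c" "x < n * (\<sigma> + 1) ^ K" and ua: "u < n" "a < \<sigma>"
    and out: "emitted out (vars s) (arrs s)" "marked (set out) (arrs s)" "length out < length es"
  shows "wp B (emit_ordinary \<sigma>) s (\<lambda>t s'. t \<le> 60 \<and>
    (\<forall>v. v \<notin> {var_y, var_z, var_pos} \<longrightarrow> vars s' v = vars s v) \<and>
    (\<forall>b. b \<notin> {arr_seen, arr_instance} \<longrightarrow> arrs s' b = arrs s b) \<and>
    (\<exists>out'. emitted out' (vars s') (arrs s') \<and> marked (set out') (arrs s') \<and>
      set out' = insert (u, a, x) (set out) \<and> length out' \<le> Suc (length out)))"
    (is "wp B _ s ?Q")
proof -
  let ?z = "(x * n + u) * \<sigma> + a"
  have seen: "arrs s arr_seen ?z = (if (u, a, x) \<in> set out then 1 else 0)"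
  proof -
    have "?z \<in> key ` set out \<longleftrightarrow> (u, a, x) \<in> set out"
    proof
      assume "?z \<in> key ` set out"
      then obtain u' a' x' where o: "(u', a', x') \<in> set out" "key (u, a, x) = key (u', a', x')"
        by (auto simp: key_def)
      then show "(u, a, x) \<in> set out"
        using out(2) key_inj[OF ua _ _ o(2)] by (auto simp: marked_def)
    next
      assume "(u, a, x) \<in> set out"
      then show "?z \<in> key ` set out"
        by (intro image_eqI[of _ _ "(u, a, x)"]) (simp_all add: key_def)
    qed
    then show ?thesis using out(2) by (simp add: marked_def)
  qed
  have xn: "x * n + u \<le> (n * (\<sigma> + 1) ^ K) * n + n"
    using x(2) ua by (intro add_mono mult_le_mono1) simp_all
  then have "(x * n + u) * \<sigma> \<le> ((n * (\<sigma> + 1) ^ K) * n + n) * \<sigma>" by (rule mult_le_mono1)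
  then have z: "?z \<le> B" using B_seen ua by linarith
  have "(n * (\<sigma> + 1) ^ K) * n + n \<le> ((n * (\<sigma> + 1) ^ K) * n + n) * \<sigma>" using ua by simp
  then have fits: "x * n + u \<le> B" "(x * n + u) * \<sigma> \<le> B" "x * n \<le> B" "x \<le> B" "n * c \<le> B" "c \<le> B" "t \<le> B"
    "u \<le> B" "a \<le> B" "n \<le> B" "\<sigma> \<le> B"
  proof -
    have "x * 1 \<le> x * n" using n_pos by (intro mult_le_mono2) simp
    moreover have "c \<le> n * c" using n_pos by simp
    moreover have "x * n + u \<le> B" using xn B_seen ua
      \<open>(n * (\<sigma> + 1) ^ K) * n + n \<le> ((n * (\<sigma> + 1) ^ K) * n + n) * \<sigma>\<close> by linarith
    moreover have "n \<le> B" using B_n by simp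
    moreover have "\<sigma> \<le> B" using B_code by simp
    ultimately show "x * n + u \<le> B" "(x * n + u) * \<sigma> \<le> B" "x * n \<le> B" "x \<le> B" "n * c \<le> B" "c \<le> B" "t \<le> B"
    "u \<le> B" "a \<le> B" "n \<le> B" "\<sigma> \<le> B" using z x(1) ua by linarith+
  qed
  let ?s' = "s\<lparr>vars := (vars s)(var_y := x, var_z := ?z)\<rparr>"
  have rest: "wp B (Cond (Read arr_seen (Var var_z)) Skip
      (Seq (Write arr_seen (Var var_z) (Lit 1)) (emit (Var var_u) (Var var_a) (Var var_y)))) ?s'
      (\<lambda>t s'. ?Q (23 + t) s')"
  proof (cases "(u, a, x) \<in> set out")
    case True
    then have "set out = insert (u, a, x) (set out)" by blast
    then show ?thesis
      using True seen z B_n out by (auto simp: emitted_def intro!: exI[of _ out])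
  next
    case False
    let ?out = "out @ [(u, a, x)]"
    have "emitted ?out ((vars s)(var_y := x, var_z := ?z, var_pos := h + 3 * length out + 3))
       ((arrs s)(arr_seen := (arrs s arr_seen)(?z := 1), arr_instance := (arrs s arr_instance)
         (h + 3 * length out := u, Suc (h + 3 * length out) := a, Suc (Suc (h + 3 * length out)) := x)))"
      using out False by (simp add: emitted_def segment_snoc3)
    moreover have "marked (set ?out)
       ((arrs s)(arr_seen := (arrs s arr_seen)(?z := 1), arr_instance := (arrs s arr_instance)
         (h + 3 * length out := u, Suc (h + 3 * length out) := a, Suc (Suc (h + 3 * length out)) := x)))"
      using out ua by (auto simp: marked_def key_def fun_eq_iff)
    ultimately show ?thesis
      using False seen z B_n B_pos out fits vars
      by (auto simp: emit_def emitted_def[of out] intro!: exI[of _ ?out])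
  qed
  show ?thesis
    using rest fits z vars 
    by (auto simp: emit_ordinary_def x(1)[symmetric] simp del: wp_Cond elim!: wp_mono)
qed


definition ordinary_edges :: "nat \<Rightarrow> (nat \<times> nat \<times> nat) set" where
  "ordinary_edges i = (\<lambda>(u, a, y). (u, a, merge y)) ` {(u, a, y) \<in> set (take i es). u < n}"

lemma ordinary_edges_Suc:
  assumes "i < length es" "es ! i = (u, a, y)"
  shows "ordinary_edges (Suc i) =
    (if u < n then insert (u, a, merge y) (ordinary_edges i) else ordinary_edges i)"
proof -
  have "{(u', a', y') \<in> set (take (Suc i) es). u' < n} = (if u < n
      then insert (u, a, y) {(u', a', y') \<in> set (take i es). u' < n}
      else {(u', a', y') \<in> set (take i es). u' < n})"
    using assms by (auto simp: take_Suc_conv_app_nth)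
  then show ?thesis
    unfolding ordinary_edges_def by (simp only: split: if_split) simp
qed

lemma merge_le:
  assumes "y < V"
  shows "merge y < n * (\<sigma> + 1) ^ K"
proof -
  have "merge y < n + n * word_code \<sigma> (word y)"
    using tgt_less[OF assms] by (simp add: merge_def)
  also have "\<dots> = n * (word_code \<sigma> (word y) + 1)" by simp
  also have "\<dots> \<le> n * (\<sigma> + 1) ^ K"
    using word_code_word_less[OF assms] by (intro mult_le_mono2) simp
  finally show ?thesis .
qed

lemma merge_edges:
  assumes env: "env (vars s) (arrs s)" and scanned: "scanned (length es) (arrs s)"
    and zero: "arrs s arr_seen = (\<lambda>_. 0)" "arrs s arr_instance = (\<lambda>_. 0)"
  shows "wp B (merge_edges \<sigma> h) s (\<lambda>t s'. t \<le> 120 * (K + 1) * (length es + 1) \<and>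
    env (vars s') (arrs s') \<and> (\<exists>out. emitted out (vars s') (arrs s') \<and>
      set out = ordinary_edges (length es) \<and> length out \<le> length es) \<and>
    vars s' var_max < (\<sigma> + 1) ^ K \<and>
    (\<forall>(u, a, y) \<in> E. word_code \<sigma> (word y) \<le> vars s' var_max))"
proof -
  define J where "J i s' \<longleftrightarrow> env (vars s') (arrs s') \<and> vars s' var_i = i \<and> scanned (length es) (arrs s') \<and>
      (\<exists>out. emitted out (vars s') (arrs s') \<and> marked (set out) (arrs s') \<and>
        set out = ordinary_edges i \<and> length out \<le> i) \<and>
      vars s' var_max < (\<sigma> + 1) ^ K \<and>
      (\<forall>(u, a, y) \<in> set (take i es). word_code \<sigma> (word y) \<le> vars s' var_max)" for i and s' :: state
  let ?e = "Bin Less (Var var_i) (Var var_e)"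
  let ?rest = "Seq (Cond (Bin Less (Var var_u) (Var var_n)) (emit_ordinary \<sigma>) Skip) increment"
  let ?body = "seq [load_edge, walk \<sigma>,
    Cond (Bin Less (Var var_max) (Var var_c)) (Assign var_max (Var var_c)) Skip,
    Cond (Bin Less (Var var_u) (Var var_n)) (emit_ordinary \<sigma>) Skip, increment]"
  have rest: "wp B ?rest s' (\<lambda>t s''. t \<le> 70 \<and> J (Suc i) s'')"
    if i: "i < length es" and e: "es ! i = (u, a, y)"
      and s': "env (vars s') (arrs s')" "vars s' var_i = i" "scanned (length es) (arrs s')"
        "vars s' var_u = u" "vars s' var_a = a" "vars s' var_y = tgt y" "vars s' var_c = word_code \<sigma> (word y)"
      and out: "emitted out (vars s') (arrs s')" "marked (set out) (arrs s')"
        "set out = ordinary_edges i" "length out \<le> i"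
      and max: "vars s' var_max < (\<sigma> + 1) ^ K"
        "\<forall>(u, a, y) \<in> set (take (Suc i) es). word_code \<sigma> (word y) \<le> vars s' var_max"
    for i u a y s' out
  proof (cases "u < n")
    case True
    note bounds = es_nthD[OF i e]
    have ordinary: "ordinary_edges (Suc i) = insert (u, a, merge y) (ordinary_edges i)"
      using ordinary_edges_Suc[OF i e] True by simp
    have "wp B (emit_ordinary \<sigma>) s' (\<lambda>t s''. t \<le> 60 \<and>
      (\<forall>v. v \<notin> {var_y, var_z, var_pos} \<longrightarrow> vars s'' v = vars s' v) \<and>
      (\<forall>b. b \<notin> {arr_seen, arr_instance} \<longrightarrow> arrs s'' b = arrs s' b) \<and>
      (\<exists>out'. emitted out' (vars s'') (arrs s'') \<and> marked (set out') (arrs s'') \<and>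
        set out' = insert (u, a, merge y) (set out) \<and> length out' \<le> Suc (length out)))"
      using s' out i True bounds merge_le[OF bounds(4)]
      by (intro emit_ordinary) (auto simp: env_def merge_def)
    then have "wp B (emit_ordinary \<sigma>) s'
      (\<lambda>t s''. t \<le> 60 \<and> vars s'' var_i = i \<and> J (Suc i) (s''\<lparr>vars := (vars s'')(var_i := Suc i)\<rparr>))"
    proof (rule wp_mono, elim conjE exE, intro conjI)
      fix t out' and s'' :: state
      assume frame: "\<forall>v. v \<notin> {var_y, var_z, var_pos} \<longrightarrow> vars s'' v = vars s' v"
        "\<forall>b. b \<notin> {arr_seen, arr_instance} \<longrightarrow> arrs s'' b = arrs s' b"
        and out': "emitted out' (vars s'') (arrs s'')" "marked (set out') (arrs s'')"
          "set out' = insert (u, a, merge y) (set out)" "length out' \<le> Suc (length out)"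
      show "vars s'' var_i = i" using frame s' by simp
      have "env (vars s'') (arrs s'')"
        using frame by (intro env_cong[OF s'(1)]) auto
      then show "J (Suc i) (s''\<lparr>vars := (vars s'')(var_i := Suc i)\<rparr>)"
        using frame s' out' out max ordinary
        by (auto simp: J_def env_def scanned_def emitted_def intro!: exI[of _ out'])
    qed
    then show ?thesis
      using s' True bounds B_n B_es i by (auto simp: increment_def env_def elim!: wp_mono)
  next
    case False
    then have "ordinary_edges (Suc i) = ordinary_edges i"
      using ordinary_edges_Suc[OF i e] by simp
    then show ?thesis
      using s' False es_nthD[OF i e] B_n B_es i out max
      by (auto simp: increment_def J_def env_def scanned_def emitted_def intro!: exI[of _ out])
  qed
  have body: "wp B ?body s' (\<lambda>t s''. t \<le> 30 * K + 110 \<and> J (Suc i) s'')"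
    if i: "i < length es" and J: "J i s'" for i s'
  proof -
    obtain u a y where e: "es ! i = (u, a, y)" by (cases "es ! i")
    note bounds = es_nthD[OF i e]
    have s': "env (vars s') (arrs s')" "vars s' var_i = i" "scanned (length es) (arrs s')"
      using J by (auto simp: J_def)
    obtain out where out: "emitted out (vars s') (arrs s')" "marked (set out) (arrs s')"
        "set out = ordinary_edges i" "length out \<le> i"
      using J by (auto simp: J_def)
    let ?c = "word_code \<sigma> (word y)"
    have max: "vars s' var_max < (\<sigma> + 1) ^ K"
      "\<forall>(u, a, y) \<in> set (take i es). word_code \<sigma> (word y) \<le> vars s' var_max"
      using J by (auto simp: J_def)
    have c: "?c < (\<sigma> + 1) ^ K"
      using word_code_word_less bounds by blast
    let ?s1 = "s'\<lparr>vars := (vars s')(var_u := u, var_a := a, var_y := y)\<rparr>"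
    have "wp B (walk \<sigma>) ?s1 (\<lambda>t s'. t \<le> 30 * K + 10 \<and>
      (\<exists>w. s' = ?s1\<lparr>vars := (vars ?s1)(var_c := ?c, var_w := w, var_y := tgt y)\<rparr>))"
      using s' bounds by (intro walk) (auto simp: env_def)
    then have "wp B (walk \<sigma>) ?s1 (\<lambda>t1 s1.
      wp B (Cond (Bin Less (Var var_max) (Var var_c)) (Assign var_max (Var var_c)) Skip) s1
        (\<lambda>t2 s2. wp B ?rest s2 (\<lambda>t3 s3. 21 + (t1 + (t2 + t3)) \<le> 30 * K + 110 \<and> J (Suc i) s3)))"
    proof (rule wp_mono, elim conjE exE)
      fix t1 w and s1 :: state
      assume t1: "t1 \<le> 30 * K + 10"
        and s1: "s1 = ?s1\<lparr>vars := (vars ?s1)(var_c := ?c, var_w := w, var_y := tgt y)\<rparr>"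
      \<comment> \<open>Writing the new value as a maximum describes the state after either branch
        of the conditional, so the rest of the pass is analysed once.\<close>
      let ?s2 = "s1\<lparr>vars := (vars s1)(var_max := max ?c (vars s' var_max))\<rparr>"
      have "wp B ?rest ?s2 (\<lambda>t s''. t \<le> 70 \<and> J (Suc i) s'')"
      proof (rule rest[OF i e])
        show "\<forall>(u, a, y) \<in> set (take (Suc i) es). word_code \<sigma> (word y) \<le> vars ?s2 var_max"
          using max(2) e i by (auto simp: take_Suc_conv_app_nth le_max_iff_disj)
        show "env (vars ?s2) (arrs ?s2)"
          using s' s1 by (auto simp: env_def)
        show "emitted out (vars ?s2) (arrs ?s2)"
          using out s1 by (auto simp: emitted_def)
      qed (use s' s1 out max c in auto)
      then have "wp B ?rest ?s2 (\<lambda>t3 s3. 21 + (t1 + (8 + t3)) \<le> 30 * K + 110 \<and> J (Suc i) s3)"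
        by (rule wp_mono) (use t1 in auto)
      moreover have "?s2 = s1" if "\<not> vars s' var_max < ?c"
      proof -
        have "max ?c (vars s' var_max) = vars s1 var_max" using that s1 by simp
        then show ?thesis by (simp only: fun_upd_triv) simp
      qed
      moreover have "max ?c (vars s' var_max) = ?c" if "vars s' var_max < ?c"
        using that by simp
      moreover have "vars s1 var_max = vars s' var_max" "vars s1 var_c = ?c"
        using s1 by simp_all
      ultimately show "wp B (Cond (Bin Less (Var var_max) (Var var_c)) (Assign var_max (Var var_c)) Skip) s1
        (\<lambda>t2 s2. wp B ?rest s2 (\<lambda>t3 s3. 21 + (t1 + (t2 + t3)) \<le> 30 * K + 110 \<and> J (Suc i) s3))"
        using max c B_code B_n by (auto simp del: wp_Seq elim!: wp_mono)
    qed
    then show ?thesis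
      by (simp add: wp_load_edge[OF s'(1,2) i e] del: wp_Cond) 
  qed
  have loop: "wp B (While ?e ?body) s' (\<lambda>t s''. t \<le> (length es - 0) * (1 + expr_time ?e + (30 * K + 110)) + (1 + expr_time ?e)
      \<and> J (length es) s'')" if "J 0 s'" for s'
  proof (rule wp_While_upto)
    fix i s' assume i: "i < length es" and J: "J i s'"
    then show "expr_fits B s' ?e \<and> expr_val s' ?e \<noteq> 0 \<and>
        wp B ?body s' (\<lambda>t s''. t \<le> 30 * K + 110 \<and> J (Suc i) s'')"
      using body B_es by (auto simp: J_def env_def simp del: wp_Seq wp_Cond)
  next
    fix s' assume "J (length es) s'"
    then show "expr_fits B s' ?e \<and> expr_val s' ?e = 0"
      using B_es by (simp add: J_def env_def)
  qed (use that in auto)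
  let ?s' = "s\<lparr>vars := (vars s)(var_i := 0, var_max := 0, var_pos := h)\<rparr>"
  have "J 0 ?s'"
    using env scanned zero
    by (auto simp: J_def env_def emitted_def marked_def ordinary_edges_def segment_Nil intro!: exI[of _ "[]"])
  from loop[OF this]
  have "wp B (While ?e ?body) ?s' (\<lambda>t s''. 6 + t \<le> 120 * (K + 1) * (length es + 1) \<and> J (length es) s'')"
    by (rule wp_mono) (auto simp: algebra_simps)
  then show ?thesis
    using B_n B_pos set_es by (auto simp: merge_edges_def J_def elim!: wp_mono)
qed

end

text \<open>Literals and variables keep their values while the array is written, so all entries can
  be evaluated in the initial state.\<close>

lemma write_list:
  assumes "\<And>e. e \<in> set xs \<Longrightarrow> (\<exists>c. e = Lit c \<and> c \<le> B) \<or> (\<exists>x. e = Var x \<and> vars s x \<le> B)"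
    and "i + length xs \<le> B"
  shows "wp B (write_list i xs) s (\<lambda>t s'. t = 3 * length xs + 1 \<and>
    s' = s\<lparr>arrs := (arrs s)(arr_instance := (\<lambda>j. if i \<le> j \<and> j < i + length xs
      then expr_val s (xs ! (j - i)) else arrs s arr_instance j))\<rparr>)"
  using assms
proof (induction xs arbitrary: i s)
  case Nil
  have "(\<lambda>j. if i \<le> j \<and> j < i then f j else g j) = g" for f g :: "nat \<Rightarrow> nat"
    by auto
  then show ?case by simp
next
  case (Cons e xs)
  let ?s' = "s\<lparr>arrs := (arrs s)(arr_instance := (arrs s arr_instance)(i := expr_val s e))\<rparr>"
  have val: "expr_val ?s' e' = expr_val s e'" if "e' \<in> set xs" for e'
    using Cons.prems(1)[of e'] that by auto
  have "wp B (write_list (Suc i) xs) ?s' (\<lambda>t s'. t = 3 * length xs + 1 \<and>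
    s' = ?s'\<lparr>arrs := (arrs ?s')(arr_instance := (\<lambda>j. if Suc i \<le> j \<and> j < Suc i + length xs
      then expr_val ?s' (xs ! (j - Suc i)) else arrs ?s' arr_instance j))\<rparr>)"
    using Cons.prems by (intro Cons.IH) auto
  moreover have "(\<lambda>j. if Suc i \<le> j \<and> j < Suc i + length xs
      then expr_val ?s' (xs ! (j - Suc i)) else arrs ?s' arr_instance j) =
    (\<lambda>j. if i \<le> j \<and> j < i + length (e # xs)
      then expr_val s ((e # xs) ! (j - i)) else arrs s arr_instance j)"
  proof
    fix j
    consider "j = i" | "j < i" | "i < j" by linarith
    then show "(if Suc i \<le> j \<and> j < Suc i + length xs
      then expr_val ?s' (xs ! (j - Suc i)) else arrs ?s' arr_instance j) =
      (if i \<le> j \<and> j < i + length (e # xs)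
        then expr_val s ((e # xs) ! (j - i)) else arrs s arr_instance j)"
    proof cases
      case 3
      then have "j - i = Suc (j - Suc i)" by simp
      moreover have "expr_val ?s' (xs ! (j - Suc i)) = expr_val s (xs ! (j - Suc i))"
        if "j < Suc i + length xs"
        using 3 that by (intro val nth_mem) auto
      ultimately show ?thesis using 3 by simp
    qed auto
  qed
  ultimately have "wp B (write_list (Suc i) xs) ?s' (\<lambda>t s'. 3 + t = 3 * length (e # xs) + 1 \<and>
    s' = s\<lparr>arrs := (arrs s)(arr_instance := (\<lambda>j. if i \<le> j \<and> j < i + length (e # xs)
      then expr_val s ((e # xs) ! (j - i)) else arrs s arr_instance j))\<rparr>)"
    by (elim wp_mono) simp
  moreover have "expr_fits B s e" "expr_time e = 1" "i \<le> B"
    using Cons.prems(1)[of e] Cons.prems(2) by auto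
  ultimately show ?case
    by simp (elim conjE wp_mono, simp add: fun_upd_def)
qed

context merging
begin

lemma word_edges:
  assumes env: "env (vars s) (arrs s)" and out: "emitted out (vars s) (arrs s)"
    and out_set: "set out = ordinary_edges (length es)" "length out \<le> length es"
    and max: "vars s var_max < (\<sigma> + 1) ^ K" and N: "N = n * (vars s var_max + 1)"
  shows "wp B (word_edges \<sigma>) s (\<lambda>t s'. t \<le> 60 * (N + 1) \<and> env (vars s') (arrs s') \<and>
    vars s' var_N = N \<and> emitted (out @ map (word_edge \<sigma> n) [n..<N]) (vars s') (arrs s'))"
proof -
  define J where "J j s' \<longleftrightarrow> env (vars s') (arrs s') \<and> vars s' var_i = j \<and> vars s' var_N = N \<and>
    emitted (out @ map (word_edge \<sigma> n) [n..<j]) (vars s') (arrs s')" for j and s' :: state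
  let ?e = "Bin Less (Var var_i) (Var var_N)"
  let ?body = "seq
    [Assign var_c (Bin Minus (Bin Div (Var var_i) (Var var_n)) (Lit 1)),
     emit (Var var_i) (Bin Mod (Var var_c) (Lit \<sigma>))
       (Bin Plus (Bin Mod (Var var_i) (Var var_n)) (Bin Times (Var var_n) (Bin Div (Var var_c) (Lit \<sigma>)))),
     increment]"
  have "N \<le> n * (\<sigma> + 1) ^ K"
    unfolding N using max by (intro mult_le_mono2) simp
  then have NB: "h + 3 * (length es + N) + 10 \<le> B"
    using B_pos by simp
  have \<sigma>B: "\<sigma> \<le> B" and nB: "n \<le> B" and nN: "n \<le> N"
    using B_code B_n N by auto
  have loop: "wp B (While ?e ?body) s' (\<lambda>t s''. t \<le> (N - n) * (1 + expr_time ?e + 50) + (1 + expr_time ?e)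
      \<and> J N s'')" if "J n s'" for s'
  proof (rule wp_While_upto)
    fix j s' assume j: "n \<le> j" "j < N" and J: "J j s'"
    define c where "c = j div n - 1"
    then have c: "j div n - Suc 0 = c" by simp
    let ?out = "out @ map (word_edge \<sigma> n) [n..<j]"
    have "j = j mod n + n * (j div n)" by simp
    moreover have "c div \<sigma> \<le> j div n"
      unfolding c_def by (rule order.trans[OF div_le_dividend]) simp
    then have "n * (c div \<sigma>) \<le> n * (j div n)"
      by (rule mult_le_mono2)
    ultimately have t: "j mod n + n * (c div \<sigma>) \<le> j" by linarith
    have "j div n \<le> j" "j mod n \<le> j" "c mod \<sigma> \<le> c" "c div \<sigma> \<le> c" "c \<le> j div n"
      by (simp_all add: c_def)
    moreover from t have "n * (c div \<sigma>) \<le> j" by (rule add_leD2)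
    moreover have "j \<le> B" using NB j by simp
    ultimately have fits: "j \<le> B" "j div n \<le> B" "j mod n \<le> B" "c \<le> B" "c mod \<sigma> \<le> B" "c div \<sigma> \<le> B"
      "n * (c div \<sigma>) \<le> B" "j mod n + n * (c div \<sigma>) \<le> B"
      using t by (blast intro: order.trans)+
    have emitted: "emitted ?out (vars s') (arrs s')" using J by (simp add: J_def)
    then have len: "vars s' var_pos = h + 3 * (length out + (j - n))"
      "arrs s' arr_instance = segment h (concat (map encode_edge ?out))"
      by (auto simp: emitted_def)
    have posB: "vars s' var_pos + 3 \<le> B"
      using len(1) NB out_set(2) j by simp
    have edge: "word_edge \<sigma> n j = (j, c mod \<sigma>, j mod n + n * (c div \<sigma>))"
      by (simp add: word_edge_def c_def)
    \<comment> \<open>All edges listed so far leave vertices below \<open>j\<close>: the ordinary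
      ones by \<open>u < n\<close>, the others because they are listed by increasing source. So
      distinctness holds without consulting the table.\<close>
    have "fst e < j" if "e \<in> set ?out" for e
      using that out_set j by (auto simp: ordinary_edges_def word_edge_def)
    then have "word_edge \<sigma> n j \<notin> set ?out"
      using edge by fastforce
    then have "emitted (out @ map (word_edge \<sigma> n) [n..<Suc j])
      ((vars s')(var_c := c, var_pos := vars s' var_pos + 3, var_i := Suc j))
      ((arrs s')(arr_instance := (arrs s' arr_instance)(vars s' var_pos := j,
        Suc (vars s' var_pos) := c mod \<sigma>, Suc (Suc (vars s' var_pos)) := j mod n + n * (c div \<sigma>))))"
    proof -
      let ?pos = "vars s' var_pos"
      have pos: "?pos = h + length (concat (map encode_edge ?out))"
        using emitted unfolding emitted_def length_concat_encode_edge by blast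
      have out_Suc: "out @ map (word_edge \<sigma> n) [n..<Suc j] = ?out @ [word_edge \<sigma> n j]"
        using j by simp
      have "segment h (concat (map encode_edge ?out) @ [j, c mod \<sigma>, j mod n + n * (c div \<sigma>)]) =
        segment h (concat (map encode_edge (?out @ [word_edge \<sigma> n j])))"
        by (simp add: edge)
      then have "(arrs s' arr_instance)(?pos := j, Suc ?pos := c mod \<sigma>,
          Suc (Suc ?pos) := j mod n + n * (c div \<sigma>)) =
        segment h (concat (map encode_edge (?out @ [word_edge \<sigma> n j])))"
        unfolding len(2) segment_snoc3[OF pos] .
      then show ?thesis
        using \<open>word_edge \<sigma> n j \<notin> set ?out\<close> emitted j unfolding out_Suc emitted_def by simp
    qed
    then show "expr_fits B s' ?e \<and> expr_val s' ?e \<noteq> 0 \<and> wp B ?body s' (\<lambda>t s''. t \<le> 50 \<and> J (Suc j) s'')"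
      using J j fits posB NB nB \<sigma>B
      by (simp add: J_def env_def emit_def increment_def c)
  next
    fix s' assume "J N s'"
    then show "expr_fits B s' ?e \<and> expr_val s' ?e = 0"
      using NB by (simp add: J_def)
  qed (use that nN in auto)
  let ?s' = "s\<lparr>vars := (vars s)(var_N := N, var_i := n)\<rparr>"
  have "J n ?s'"
    using env out by (simp add: J_def env_def emitted_def)
  from loop[OF this]
  have "wp B (While ?e ?body) ?s' (\<lambda>t s''. 8 + t \<le> 60 * (N + 1) \<and> J N s'')"
    by (rule wp_mono) (auto simp: algebra_simps)
  moreover have "vars s var_max + 1 \<le> B" "n * (vars s var_max + 1) = N"
    using max B_code N by auto
  ultimately show ?thesis
    using env NB nB B_n by (auto simp: word_edges_def env_def J_def elim!: wp_mono)
qed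

lemma copy_output:
  assumes "vars s var_n = n" "vars s var_N = N" "N \<le> n * (\<sigma> + 1) ^ K"
    and r: "\<And>u v. u < n \<Longrightarrow> v < n \<Longrightarrow> arrs s arr_result (u * N + v) = r u v" "\<And>u v. r u v \<le> 1"
  shows "wp B copy_output s (\<lambda>t s'. t \<le> 40 * (n * n + 1) \<and>
    (\<forall>u<n. \<forall>v<n. arrs s' 1 (u * n + v) = r u v))"
proof -
  define J where "J i s' \<longleftrightarrow> vars s' var_n = n \<and> vars s' var_N = N \<and> vars s' var_i = i \<and>
    arrs s' arr_result = arrs s arr_result \<and> (\<forall>j<i. arrs s' 1 j = r (j div n) (j mod n))"
    for i and s' :: state
  let ?e = "Bin Less (Var var_i) (Bin Times (Var var_n) (Var var_n))"
  let ?body = "seq [Write 1 (Var var_i) (Read arr_result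
     (Bin Plus (Bin Times (Bin Div (Var var_i) (Var var_n)) (Var var_N)) (Bin Mod (Var var_i) (Var var_n)))),
   increment]"
  have nB: "n * n + 10 \<le> B" "n \<le> B" and NB: "n * N + n \<le> B"
  proof -
    show "n * n + 10 \<le> B" "n \<le> B" using B_n by auto
    have "n * N \<le> n * (n * (\<sigma> + 1) ^ K)"
      using assms(3) by (rule mult_le_mono2)
    then show "n * N + n \<le> B" using B_matrix by linarith
  qed
  have loop: "wp B (While ?e ?body) s' (\<lambda>t s''. t \<le> (n * n - 0) * (1 + expr_time ?e + 20) + (1 + expr_time ?e)
      \<and> J (n * n) s'')" if "J 0 s'" for s'
  proof (rule wp_While_upto)
    fix i s' assume i: "i < n * n" and J: "J i s'"
    have uv: "i div n < n" "i mod n < n"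
      using i n_pos by (auto simp: less_mult_imp_div_less)
    have "(i div n) * N \<le> n * N" using uv by (intro mult_le_mono1) simp
    moreover have "N \<le> n * N" using n_pos by simp
    ultimately have "i div n * N + i mod n \<le> B" "i div n * N \<le> B" "N \<le> B"
      using uv NB by linarith+
    moreover have "arrs s arr_result (i div n * N + i mod n) = r (i div n) (i mod n)"
      using r(1) uv by blast
    moreover have "r (i div n) (i mod n) \<le> B" using r(2)[of "i div n" "i mod n"] nB by linarith
    ultimately show "expr_fits B s' ?e \<and> expr_val s' ?e \<noteq> 0 \<and>
        wp B ?body s' (\<lambda>t s''. t \<le> 20 \<and> J (Suc i) s'')"
      using J i nB uv by (auto simp: J_def increment_def less_Suc_eq)
  next
    fix s' assume "J (n * n) s'"
    then show "expr_fits B s' ?e \<and> expr_val s' ?e = 0"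
      using nB by (simp add: J_def)
  qed (use that in auto)
  have result: "\<forall>u<n. \<forall>v<n. arrs s' 1 (u * n + v) = r u v" if "J (n * n) s'" for s'
  proof (intro allI impI)
    fix u v assume uv: "u < n" "v < n"
    then have "u * n + v < Suc u * n" by simp
    also have "\<dots> \<le> n * n" using uv by (intro mult_le_mono1) simp
    finally show "arrs s' 1 (u * n + v) = r u v"
      using that uv by (simp add: J_def)
  qed
  let ?s' = "s\<lparr>vars := (vars s)(var_i := 0)\<rparr>"
  have "J 0 ?s'" using assms by (simp add: J_def)
  from loop[OF this]
  have "wp B (While ?e ?body) ?s' (\<lambda>t s''. 2 + t \<le> 40 * (n * n + 1) \<and> J (n * n) s'')"
    by (rule wp_mono) auto
  then show ?thesis
    using result by (auto simp: copy_output_def elim!: wp_mono)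
qed

end

text \<open>Bounds every number that the grammar contributes to an instance; a constant once the
  grammar is fixed.\<close>

definition header_bound :: "(nat, nat) cfg \<Rightarrow> (nat \<times> (nat, nat) sym list) list \<Rightarrow> nat" where
  "header_bound G ps = card (nonterms G) + card (terms G) + start G + length ps +
     sum_list (concat (map encode_prod ps))"

text \<open>The word bound of the given program is a power of this quantity, which is linear in the
  numbers of edges and vertices.\<close>

lemma encode_instance_size:
  assumes "\<And>u a v. (u, a, v) \<in> set es \<Longrightarrow> u < N \<and> a < card (terms G) \<and> v < N"
  shows "length (encode_instance G ps N es) + Max (set (encode_instance G ps N es)) \<le>
    6 + length (concat (map encode_prod ps)) + header_bound G ps + 4 * length es + N"
proof -
  have "x \<le> header_bound G ps + length es + N" if "x \<in> set (encode_instance G ps N es)" for x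
  proof -
    have "x \<le> sum_list (concat (map encode_prod ps))" if "x \<in> set (concat (map encode_prod ps))"
      by (rule member_le_sum_list) (use that in auto)
    moreover have "x \<le> N + card (terms G)" if "x \<in> set (concat (map encode_edge es))"
    proof -
      from that obtain u a v where "(u, a, v) \<in> set es" "x \<in> {u, a, v}" by auto
      with assms[of u a v] show ?thesis by auto
    qed
    moreover have "x \<in> set [N, card (nonterms G), card (terms G), start G, length ps, length es] \<or>
        x \<in> set (concat (map encode_prod ps)) \<or> x \<in> set (concat (map encode_edge es))"
      using that unfolding encode_instance_def set_append by blast
    ultimately show ?thesis
      by (auto simp: header_bound_def simp del: set_concat)
  qed
  then have "Max (set (encode_instance G ps N es)) \<le> header_bound G ps + length es + N"
    by (intro Max.boundedI) (auto simp: encode_instance_def)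
  moreover have "length (encode_instance G ps N es) = 6 + length (concat (map encode_prod ps)) + 3 * length es"
    by (simp only: encode_instance_def length_append length_concat_encode_edge) simp
  ultimately show ?thesis by linarith
qed

lemma segment_0_append:
  "segment 0 (xs @ ys) j = (if j < length xs then xs ! j else segment (length xs) ys j)"
  by (auto simp: segment_def nth_append)

context merging
begin

lemma write_header:
  assumes env: "env (vars s) (arrs s)" and N: "vars s var_N = N" "N \<le> n * (\<sigma> + 1) ^ K"
    and out: "emitted out (vars s) (arrs s)" "length out \<le> length es + N"
    and h: "h = 6 + length (concat (map encode_prod ps))"
    and B_header: "header_bound G ps \<le> B"
  shows "wp B (write_header G ps h) s (\<lambda>t s'. t \<le> 3 * h + 10 \<and> env (vars s') (arrs s') \<and>
    vars s' var_N = N \<and> arrs s' arr_instance = segment 0 (encode_instance G ps N out))"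
proof -
  let ?es = "[Var var_N, Lit (card (nonterms G)), Lit (card (terms G)), Lit (start G), Lit (length ps), Var var_z]
         @ map Lit (concat (map encode_prod ps))"
  let ?s = "s\<lparr>vars := (vars s)(var_z := length out)\<rparr>"
  let ?hd = "[N, card (nonterms G), card (terms G), start G, length ps, length out] @ concat (map encode_prod ps)"
  have B: "h + 3 * (length es + N) + 10 \<le> B"
    using B_pos N(2) by simp
  have len: "length ?es = h" "length ?hd = h" by (simp_all add: h)
  have consts_le: "c \<le> B" if "c \<in> {card (nonterms G), card (terms G), start G, length ps} \<union>
      set (concat (map encode_prod ps))" for c
  proof -
    have "c \<le> sum_list (concat (map encode_prod ps))" if "c \<in> set (concat (map encode_prod ps))"
      by (rule member_le_sum_list) (use that in auto)
    then have "c \<le> header_bound G ps"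
      using that by (auto simp: header_bound_def simp del: set_concat)
    then show ?thesis using B_header by simp
  qed
  have header: "wp B (write_list 0 ?es) ?s (\<lambda>t s'. t = 3 * length ?es + 1 \<and>
    s' = ?s\<lparr>arrs := (arrs ?s)(arr_instance := (\<lambda>j. if 0 \<le> j \<and> j < 0 + length ?es
      then expr_val ?s (?es ! (j - 0)) else arrs ?s arr_instance j))\<rparr>)"
  proof (rule write_list)
    fix e assume "e \<in> set ?es"
    then have "e = Var var_N \<or> e = Var var_z \<or> (\<exists>c \<in> {card (nonterms G), card (terms G), start G, length ps} \<union>
      set (concat (map encode_prod ps)). e = Lit c)" by auto
    then show "(\<exists>c. e = Lit c \<and> c \<le> B) \<or> (\<exists>x. e = Var x \<and> vars ?s x \<le> B)"
      using consts_le N B out(2) by (auto simp del: set_concat)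
  qed (use B len in simp)
  have result: "(\<lambda>j. if 0 \<le> j \<and> j < 0 + length ?es
      then expr_val ?s (?es ! (j - 0)) else arrs ?s arr_instance j) = segment 0 (encode_instance G ps N out)"
  proof
    fix j
    have inst: "encode_instance G ps N out = ?hd @ concat (map encode_edge out)"
      by (simp add: encode_instance_def)
    have "map (expr_val ?s) ?es = ?hd"
      using N by (simp add: comp_def)
    then have "expr_val ?s (?es ! j) = ?hd ! j" if "j < h"
      using that len(1) nth_map[of j ?es "expr_val ?s"] by metis
    moreover have "arrs ?s arr_instance j = segment h (concat (map encode_edge out)) j"
      using out(1) by (simp add: emitted_def)
    ultimately show "(if 0 \<le> j \<and> j < 0 + length ?es
      then expr_val ?s (?es ! (j - 0)) else arrs ?s arr_instance j) = segment 0 (encode_instance G ps N out) j"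
      unfolding inst segment_0_append len by (cases "j < h") simp_all
  qed
  have "wp B (write_list 0 ?es) ?s (\<lambda>t s'. 6 + t \<le> 3 * h + 10 \<and> env (vars s') (arrs s') \<and>
    vars s' var_N = N \<and> arrs s' arr_instance = segment 0 (encode_instance G ps N out))"
    using header
  proof (rule wp_mono)
    fix t and s' :: state
    assume "t = 3 * length ?es + 1 \<and>
      s' = ?s\<lparr>arrs := (arrs ?s)(arr_instance := (\<lambda>j. if 0 \<le> j \<and> j < 0 + length ?es
        then expr_val ?s (?es ! (j - 0)) else arrs ?s arr_instance j))\<rparr>"
    then have "t = 3 * h + 1"
      "s' = ?s\<lparr>arrs := (arrs ?s)(arr_instance := segment 0 (encode_instance G ps N out))\<rparr>"
      unfolding result unfolding len by blast+
    then show "6 + t \<le> 3 * h + 10 \<and> env (vars s') (arrs s') \<and>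
      vars s' var_N = N \<and> arrs s' arr_instance = segment 0 (encode_instance G ps N out)"
      using env N by (simp add: env_def)
  qed
  moreover have "vars s var_pos = h + 3 * length out" "h + 3 * length out \<le> B"
    using out B by (auto simp: emitted_def)
  ultimately show ?thesis
    using B by (auto simp: write_header_def simp del: write_list.simps elim!: wp_mono)
qed

text \<open>On the names reserved for the renamed program, \<open>untouched\<close> and the content
  of \<open>arr_instance\<close> make \<open>s\<close> look like the initial state for
  \<open>xs\<close>, so the simulation applies.\<close>

lemma shift_com_input:
  assumes p: "exec B' p (input_state xs) t s'" "B' \<le> B"
    and env: "env (vars s) (arrs s)" and xs: "arrs s arr_instance = segment 0 xs"
  shows "wp B (shift_com first_free_var arr_instance p) s (\<lambda>t' S. t' = t \<and>
    (\<forall>v<first_free_var. vars S v = vars s v) \<and> arrs S arr_result = arrs s' 1)"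
proof -
  have "arrs s (a + arr_instance) = arrs (input_state xs) a" for a
    using env xs by (cases "a = 0") (auto simp: env_def untouched_def input_state_def segment_def)
  moreover have "vars s (x + first_free_var) = vars (input_state xs) x" for x
    using env by (simp add: env_def untouched_def input_state_def)
  ultimately have "shifted first_free_var arr_instance (input_state xs) s"
    by (simp add: shifted_def)
  then obtain S where "exec B (shift_com first_free_var arr_instance p) s t S"
    "shifted first_free_var arr_instance s' S" "agree_below first_free_var arr_instance s S"
    using exec_shift_com[OF exec_mono[OF p]] by blast
  moreover from this(2) have "arrs S (1 + arr_instance) = arrs s' 1"
    unfolding shifted_def by blast
  ultimately show ?thesis
    unfolding wp_def by (intro exI[of _ t] exI[of _ S]) (simp add: agree_below_def)
qed

text \<open>The time is stated for the actual \<open>N\<close>, which depends on the instance: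
  \<open>T\<close> is not known to be monotone here, so its argument cannot yet be replaced by the
  bound on \<open>N\<close>.\<close>

lemma reduction_correct:
  assumes G: "numbered_cfg G" "card (terms G) = \<sigma>" and ps: "enumerates ps (prods G)"
    and h: "h = 6 + length (concat (map encode_prod ps))"
    and p: "\<And>D N es'. wf_lgraph (terms G) D \<Longrightarrow> verts D = {..<N} \<Longrightarrow> enumerates es' (edges D) \<Longrightarrow>
        \<exists>t s. terminates_in d p (encode_instance G ps N es') t s \<and> real t \<le> T N \<and> correct_output G D N s"
    and D: "verts D = {..<V}" "edges D = E"
    and B_header: "header_bound G ps \<le> B"
    and B_p: "(h + header_bound G ps + 5 * (length es + n * (\<sigma> + 1) ^ K)) ^ d \<le> B"
  shows "\<exists>t s N. exec B (reduction G ps p) (input_state (encode_subdivision n m es)) t s \<and>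
    correct_output G D n s \<and> n \<le> N \<and> N \<le> n * (\<sigma> + 1) ^ K \<and>
    real t \<le> T N + 3 * h + 300 * ((K + 1) * (length es + 1) + N + n * n + 1)"
proof -
  let ?R = "n * (\<sigma> + 1) ^ K"
  have terms: "terms G = {..<\<sigma>}" using G by (simp add: numbered_cfg_def)
  let ?s0 = "input_state (encode_subdivision n m es)"
  have "wp B scan_edges ?s0 (\<lambda>t s'. t \<le> 40 * (length es + 1) \<and> env (vars s') (arrs s') \<and>
    scanned (length es) (arrs s') \<and> arrs s' arr_seen = (\<lambda>_. 0) \<and> arrs s' arr_instance = (\<lambda>_. 0))"
    by (rule scan_edges[OF holds_input_input_state]) (auto simp: input_state_def untouched_def)
  then obtain t1 s1 where 1: "exec B scan_edges ?s0 t1 s1" "t1 \<le> 40 * (length es + 1)"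
    "env (vars s1) (arrs s1)" "scanned (length es) (arrs s1)"
    "arrs s1 arr_seen = (\<lambda>_. 0)" "arrs s1 arr_instance = (\<lambda>_. 0)"
    unfolding wp_def by blast
  from merge_edges[OF this(3-6)] obtain t2 s2 out where 2: "exec B (merge_edges \<sigma> h) s1 t2 s2"
    "t2 \<le> 120 * (K + 1) * (length es + 1)" "env (vars s2) (arrs s2)"
    "emitted out (vars s2) (arrs s2)" "set out = ordinary_edges (length es)" "length out \<le> length es"
    "vars s2 var_max < (\<sigma> + 1) ^ K" "\<forall>(u, a, y) \<in> E. word_code \<sigma> (word y) \<le> vars s2 var_max"
    unfolding wp_def by blast
  define N where "N = n * (vars s2 var_max + 1)"
  define out' where "out' = out @ map (word_edge \<sigma> n) [n..<N]"
  from word_edges[OF 2(3-7) N_def] obtain t3 s3 where 3: "exec B (word_edges \<sigma>) s2 t3 s3"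
    "t3 \<le> 60 * (N + 1)" "env (vars s3) (arrs s3)" "vars s3 var_N = N" "emitted out' (vars s3) (arrs s3)"
    unfolding wp_def out'_def by blast
  have N: "n \<le> N" "N \<le> ?R"
    unfolding N_def using 2(7) mult_le_mono2[of "vars s2 var_max + 1" "(\<sigma> + 1) ^ K" n] by simp_all
  have merge_less: "merge x < N" if "x < V" for x
  proof (cases "x < n")
    case True
    then show ?thesis using N merge_ordinary[of x] by simp
  next
    case False
    \<comment> \<open>The maximum in \<open>var_max\<close> ranges over targets of edges, so
      \<open>x\<close> has to be one.\<close>
    with that have "\<exists>u a. (u, a, x) \<in> E" by (intro in_edge) auto
    then obtain u a where "(u, a, x) \<in> E" by blast
    then have "n * word_code \<sigma> (word x) \<le> n * vars s2 var_max"
      using 2(8) by (intro mult_le_mono2) auto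
    then show ?thesis
      using tgt_less[OF that] unfolding merge_def N_def distrib_left mult_1_right by linarith
  qed
  \<comment> \<open>Without terminals the strict bound on the largest code is 1, which makes
    \<open>N\<close> equal to \<open>n\<close>.\<close>
  have \<sigma>: "0 < \<sigma>" if "n < N"
    using that 2(7) by (cases "\<sigma> = 0") (auto simp: N_def)
  have "set out' = edges (merged_graph N)" "verts (merged_graph N) = {..<N}"
    using 2(5) set_es by (simp_all add: out'_def merged_graph_def ordinary_edges_def)
  moreover have "distinct out'" using 3(5) by (simp add: emitted_def)
  ultimately have inst: "wf_lgraph (terms G) (merged_graph N)" "verts (merged_graph N) = {..<N}"
    "enumerates out' (edges (merged_graph N))"
    using wf_merged_graph[OF N(1) merge_less \<sigma>] by (auto simp: terms enumerates_def)
  from p[OF this] obtain tp sp where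
    tp: "terminates_in d p (encode_instance G ps N out') tp sp" "real tp \<le> T N"
      "correct_output G (merged_graph N) N sp"
    by blast
  have len: "length out' \<le> length es + N"
    using 2(6) by (simp add: out'_def)
  from write_header[OF 3(3,4) N(2) 3(5) len h B_header] obtain t4 s4 where
    4: "exec B (write_header G ps h) s3 t4 s4" "t4 \<le> 3 * h + 10" "env (vars s4) (arrs s4)"
      "vars s4 var_N = N" "arrs s4 arr_instance = segment 0 (encode_instance G ps N out')"
    unfolding wp_def by blast
  let ?xs = "encode_instance G ps N out'"
  have "(length ?xs + Max (set ?xs)) ^ d \<le> B"
  proof -
    have "length ?xs + Max (set ?xs) \<le>
        6 + length (concat (map encode_prod ps)) + header_bound G ps + 4 * length out' + N"
      by (rule encode_instance_size)
        (use inst G terms in \<open>auto simp: enumerates_def wf_lgraph_def\<close>)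
    then have "length ?xs + Max (set ?xs) \<le> h + header_bound G ps + 4 * length out' + N"
      by (simp only: h)
    also have "\<dots> \<le> h + header_bound G ps + 5 * (length es + ?R)"
      using len N(2) by simp
    finally show ?thesis
      using B_p power_mono[of _ _ d] order.trans by blast
  qed
  from shift_com_input[OF tp(1)[unfolded terminates_in_def] this 4(3,5)] obtain s5 where
    5: "exec B (shift_com first_free_var arr_instance p) s4 tp s5"
      "\<forall>v<first_free_var. vars s5 v = vars s4 v" "arrs s5 arr_result = arrs sp 1"
    unfolding wp_def by blast
  define r where "r u v = (if S_path_exists G D u v then 1 else 0 :: nat)" for u v
  have "vars s5 var_n = n" "vars s5 var_N = N"
    using 4 5 by (auto simp: env_def)
  moreover have "arrs s5 arr_result (u * N + v) = r u v" if "u < n" "v < n" for u v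
  proof -
    have "S_path_exists G (merged_graph N) u v \<longleftrightarrow> S_path_exists G D u v"
      by (rule S_path_exists_merged[OF N(1) merge_less \<sigma> D that])
    then show ?thesis
      using that tp(3) N(1) by (simp add: 5 correct_output_def r_def)
  qed
  moreover have "r u v \<le> 1" for u v by (simp add: r_def)
  ultimately obtain t6 s6 where 6: "exec B copy_output s5 t6 s6" "t6 \<le> 40 * (n * n + 1)"
    "\<forall>u<n. \<forall>v<n. arrs s6 1 (u * n + v) = r u v"
    using copy_output[of s5 N r] N(2) unfolding wp_def by blast
  let ?t = "t1 + (t2 + (t3 + (t4 + (tp + t6))))"
  have "exec B (reduction G ps p) ?s0 ?t s6"
    unfolding reduction_def Let_def seq.simps G(2) h[symmetric]
    by (intro exec.Seq[OF 1(1)] exec.Seq[OF 2(1)] exec.Seq[OF 3(1)] exec.Seq[OF 4(1)] exec.Seq[OF 5(1)] 6(1))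
  moreover have "real ?t \<le> T N + 3 * h + 300 * ((K + 1) * (length es + 1) + N + n * n + 1)"
  proof -
    define X where "X = (K + 1) * (length es + 1)"
    have "length es + 1 \<le> X" "t2 \<le> 120 * X"
      using 2(2) by (simp_all add: X_def algebra_simps)
    then have "t1 + t2 + t3 + t4 + t6 \<le> 3 * h + 300 * (X + N + n * n + 1)"
      using 1(2) 3(2) 4(2) 6(2) by simp
    then have "t1 + t2 + t3 + t4 + t6 \<le> 3 * h + 300 * ((K + 1) * (length es + 1) + N + n * n + 1)"
      by (simp only: X_def)
    then have "real (t1 + t2 + t3 + t4 + t6) \<le> real (3 * h + 300 * ((K + 1) * (length es + 1) + N + n * n + 1))"
      by (simp only: of_nat_le_iff)
    then show ?thesis using tp(2) by simp
  qed
  moreover have "correct_output G D n s6"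
    using 6(3) by (simp add: correct_output_def r_def)
  ultimately show ?thesis using N by blast
qed

end

section \<open>The time bound\<close>

text \<open>A single grammar serves for all \<open>n\<close>, so the polynomial factor becomes the
  constant \<open>A\<close>. The complete graph includes loops, so all n * n cells of an array that
  starts out zero must change, and n ^ 2 \<le> A * n powr c for all \<open>n > 0\<close> rules out
  \<open>c < 2\<close>.\<close>

lemma solves_all_pairs_exponent_ge_2:
  fixes c C :: real and q :: "real poly"
  assumes "solves_all_pairs p (\<lambda>n g. C * (real n powr c * poly q (real g)))"
  shows "c \<ge> 2"
proof (rule ccontr)
  assume "\<not> c \<ge> 2"
  define G :: "(nat, nat) cfg" where
    "G = \<lparr>nonterms = {0}, terms = {0}, prods = {(0, [Tm 0])}, start = 0\<rparr>"
  define A where "A = C * poly q (real (cfg_size G))"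
  obtain d where d: "\<And>D n ps es. numbered_cfg G \<and> wf_lgraph (terms G) D \<and> verts D = {..<n} \<and>
        enumerates ps (prods G) \<and> enumerates es (edges D) \<Longrightarrow>
        \<exists>t s. terminates_in d p (encode_instance G ps n es) t s \<and>
               real t \<le> C * (real n powr c * poly q (real (cfg_size G))) \<and> correct_output G D n s"
    using assms unfolding solves_all_pairs_def by blast
  have G: "numbered_cfg G" "enumerates [(0, [Tm 0])] (prods G)"
    by (auto simp: numbered_cfg_def wf_cfg_def enumerates_def G_def)
  have "derives1 G [NT 0] [Tm 0]"
    using derives1.intros[of 0 "[Tm 0]" G "[]" "[]"] by (simp add: G_def)
  then have lang: "[0] \<in> lang G"
    by (auto simp: lang_def G_def)
  have bound: "real n ^ 2 \<le> A * real n powr c" if n: "n > 0" for n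
  proof -
    define D :: "(nat, nat) lgraph" where "D = \<lparr>verts = {..<n}, edges = {..<n} \<times> {0} \<times> {..<n}\<rparr>"
    have "finite (edges D)" by (simp add: D_def)
    then obtain es where es: "enumerates es (edges D)"
      unfolding enumerates_def using finite_distinct_list by blast
    have "wf_lgraph (terms G) D"
      using n by (auto simp: wf_lgraph_def D_def G_def)
    with G es obtain t s where t: "terminates_in d p (encode_instance G [(0, [Tm 0])] n es) t s"
      "real t \<le> C * (real n powr c * poly q (real (cfg_size G)))" "correct_output G D n s"
      using d[of D n "[(0, [Tm 0])]" es] by (auto simp: D_def)
    have path: "S_path_exists G D u v" if "u < n" "v < n" for u v
    proof -
      have "labelled_path D u [0] v"
        using that by (intro labelled_path.edge[of u 0 v] labelled_path.empty) (auto simp: D_def)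
      then show ?thesis using lang unfolding S_path_exists_def by blast
    qed
    have sub: "{..<n * n} \<subseteq> changed 1 (input_state (encode_instance G [(0, [Tm 0])] n es)) s"
    proof
      fix i assume "i \<in> {..<n * n}"
      then have "i div n < n" "i mod n < n"
        using n by (auto simp: less_mult_imp_div_less)
      moreover have "\<forall>u<n. \<forall>v<n. arrs s 1 (u * n + v) = 1"
        using t(3) path unfolding correct_output_def by simp
      ultimately have "arrs s 1 (i div n * n + i mod n) = 1" by blast
      then show "i \<in> changed 1 (input_state (encode_instance G [(0, [Tm 0])] n es)) s"
        by (simp add: changed_def input_state_def)
    qed
    have fin: "finite (changed 1 (input_state (encode_instance G [(0, [Tm 0])] n es)) s)"
      "card (changed 1 (input_state (encode_instance G [(0, [Tm 0])] n es)) s) \<le> t"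
      using exec_card_changed t(1) unfolding terminates_in_def by blast+
    have "n * n \<le> t"
      using card_mono[OF fin(1) sub] fin(2) by simp
    then have "real (n * n) \<le> real t" by (simp only: of_nat_le_iff)
    then show ?thesis
      using t(2) by (simp add: A_def power2_eq_square mult_ac)
  qed
  have "filterlim (\<lambda>n. real n powr (2 - c)) at_top at_top"
    using \<open>\<not> c \<ge> 2\<close> by real_asymp
  then have "eventually (\<lambda>n. real n powr (2 - c) > A \<and> n > 0) at_top"
    by (intro eventually_conj eventually_gt_at_top) (simp add: filterlim_at_top_dense)
  then obtain n where n: "real n powr (2 - c) > A" "n > 0"
    by (auto simp: eventually_at_top_linorder)
  then have "A * real n powr c < real n powr (2 - c) * real n powr c"
    by (intro mult_strict_right_mono) auto
  also have "\<dots> = real n ^ 2"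
    using n by (simp flip: powr_add)
  finally show False using bound[OF n(2)] by simp
qed

section \<open>Growth of powers with exponent o(log n)\<close>

lemma power_smallo_ln_le_powr:
  fixes k :: "nat \<Rightarrow> nat" and b \<epsilon> :: real
  assumes k: "(\<lambda>n. real (k n)) \<in> o(\<lambda>n. ln (real n))" and b: "b \<ge> 1" and \<epsilon>: "\<epsilon> > 0"
  shows "eventually (\<lambda>n. b ^ k n \<le> real n powr \<epsilon>) at_top"
proof -
  have lnb: "ln b \<ge> 0" using b by simp
  \<comment> \<open>The added 1 keeps the divisor positive when \<open>b\<close> is 1.\<close>
  have "eventually (\<lambda>n. norm (real (k n)) \<le> (\<epsilon> / (ln b + 1)) * norm (ln (real n))) at_top"
    using lnb \<epsilon> by (intro landau_o.smallD[OF k]) auto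
  then show ?thesis
    using eventually_gt_at_top[of 0]
  proof eventually_elim
    case (elim n)
    then have ln: "ln (real n) \<ge> 0" by simp
    have "ln b * real (k n) \<le> (ln b + 1) * (\<epsilon> / (ln b + 1) * ln (real n))"
      using elim lnb ln by (intro mult_mono) auto
    also have "\<dots> = \<epsilon> * ln (real n)"
      using lnb by (simp add: field_simps)
    finally have "exp (ln b * real (k n)) \<le> exp (\<epsilon> * ln (real n))" by simp
    moreover have "b ^ k n = exp (ln b * real (k n))"
      using b by (simp add: exp_of_nat2_mult mult.commute flip: powr_realpow)
    ultimately show ?case
      using elim(2) by (simp add: powr_def)
  qed
qed

text \<open>The exponent of the word bound must serve every \<open>n\<close>, not only large ones;
  the finitely many exceptions are absorbed into the constant.\<close>

lemma linear_bound_of_eventually: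
  fixes f :: "nat \<Rightarrow> nat"
  assumes "eventually (\<lambda>n. f n \<le> n) at_top"
  obtains C where "\<And>n. n > 0 \<Longrightarrow> f n \<le> C * n"
proof -
  obtain n0 where n0: "\<And>n. n \<ge> n0 \<Longrightarrow> f n \<le> n"
    using assms by (auto simp: eventually_at_top_linorder)
  have "f n \<le> (1 + sum f {..<n0}) * n" if "n > 0" for n
  proof (cases "n < n0")
    case True
    then have "f n \<le> sum f {..<n0}" by (intro member_le_sum) auto
    also have "\<dots> \<le> (1 + sum f {..<n0}) * n" using that by (cases n) auto
    finally show ?thesis .
  next
    case False
    then show ?thesis using n0[of n] by simp
  qed
  then show thesis by (rule that)
qed

text \<open>\<open>Y\<close> dominates all parameters at once. The largest value computed by the
  reduction itself is the index into the table, of degree 4 in \<open>Y\<close>; a fifth factor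
  absorbs constants and lower terms. The exponent \<open>d + 1\<close> covers both these values and
  the \<open>d\<close>-th power required by the given program.\<close>

lemma word_bounds:
  fixes n R e s V h g Y d :: nat
  assumes "n \<le> Y" "R \<le> Y" "e \<le> Y" "s + 1 \<le> Y" "V \<le> 2 * Y" "h + g \<le> Y" "20 \<le> Y"
  shows "n * (n + 1) + 10 \<le> (Y ^ 5) ^ (d + 1)"
    and "n * (n * R) + n \<le> (Y ^ 5) ^ (d + 1)"
    and "3 * e + 10 \<le> (Y ^ 5) ^ (d + 1)"
    and "V \<le> (Y ^ 5) ^ (d + 1)"
    and "R + s + 1 \<le> (Y ^ 5) ^ (d + 1)"
    and "((n * R) * n + n) * s + s \<le> (Y ^ 5) ^ (d + 1)"
    and "h + 3 * (e + n * R) + 10 \<le> (Y ^ 5) ^ (d + 1)"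
    and "g \<le> (Y ^ 5) ^ (d + 1)"
    and "(h + g + 5 * (e + n * R)) ^ d \<le> (Y ^ 5) ^ (d + 1)"
proof -
  have hg: "h \<le> Y" "g \<le> Y" using assms(6) by simp_all
  have Y5: "Y ^ 5 \<le> (Y ^ 5) ^ (d + 1)"
    using assms(7) power_increasing[of 1 "d + 1" "Y ^ 5"] by simp
  have nR: "n * R \<le> Y * Y" and nn: "n * n \<le> Y * Y"
    using assms by (auto intro: mult_le_mono)
  have nRn: "n * R * n \<le> Y * Y * Y" using nR assms by (intro mult_le_mono) auto
  \<comment> \<open>As \<open>Y\<close> is at least 20, each power of \<open>Y\<close> swallows
    twenty times the previous one; linear arithmetic then suffices.\<close>
  have Y2: "20 * Y \<le> Y * Y" and Y3: "20 * (Y * Y) \<le> Y * Y * Y" and Y4: "20 * (Y * Y * Y) \<le> Y * Y * Y * Y"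
    using assms(7) by (simp_all add: mult_le_mono)
  have pow: "Y ^ 5 = Y * Y * Y * Y * Y" by (simp add: eval_nat_numeral)
  have Y5': "20 * (Y * Y * Y * Y) \<le> Y ^ 5"
    unfolding pow using assms(7) by (simp add: mult_le_mono)
  have "((n * R) * n + n) * s \<le> (Y * Y * Y + Y) * Y"
    using nRn assms by (intro mult_le_mono add_mono) auto
  also have "\<dots> = Y * Y * Y * Y + Y * Y" by (simp add: algebra_simps)
  finally have nRns: "((n * R) * n + n) * s \<le> Y * Y * Y * Y + Y * Y" .
  have enR: "3 * (e + n * R) \<le> 3 * Y + 3 * (Y * Y)" "5 * (e + n * R) \<le> 5 * Y + 5 * (Y * Y)"
    using nR assms(3) by simp_all
  have "n * (n + 1) = n * n + n" "n * (n * R) = n * R * n" by simp_all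
  then show "n * (n + 1) + 10 \<le> (Y ^ 5) ^ (d + 1)" "n * (n * R) + n \<le> (Y ^ 5) ^ (d + 1)"
    "3 * e + 10 \<le> (Y ^ 5) ^ (d + 1)" "V \<le> (Y ^ 5) ^ (d + 1)" "R + s + 1 \<le> (Y ^ 5) ^ (d + 1)"
    "((n * R) * n + n) * s + s \<le> (Y ^ 5) ^ (d + 1)" "h + 3 * (e + n * R) + 10 \<le> (Y ^ 5) ^ (d + 1)"
    "g \<le> (Y ^ 5) ^ (d + 1)"
    using assms(1-5,7) hg enR nR nn nRn nRns Y2 Y3 Y4 Y5' Y5 by linarith+
  have "h + g + 5 * (e + n * R) \<le> Y ^ 5"
    using hg enR Y2 Y3 Y4 Y5' by linarith
  then have "(h + g + 5 * (e + n * R)) ^ d \<le> (Y ^ 5) ^ d" by (rule power_mono) simp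
  also have "\<dots> \<le> (Y ^ 5) ^ (d + 1)"
    using assms(7) by (intro power_increasing) auto
  finally show "(h + g + 5 * (e + n * R)) ^ d \<le> (Y ^ 5) ^ (d + 1)" .
qed

text \<open>The word bound is a pure power of \<open>M\<close> without a constant factor, so the
  factor \<open>W\<close> has to move into the exponent.\<close>

lemma mult_le_power:
  fixes W M :: nat
  assumes "M \<ge> 2"
  shows "W * M \<le> M ^ (W + 1)"
proof -
  have "W \<le> 2 ^ W" by (simp add: less_imp_le)
  also have "\<dots> \<le> M ^ W" using assms by (rule power_mono) simp
  finally show ?thesis by simp
qed

lemma subdivision_time_bound:
  fixes k :: "nat \<Rightarrow> nat" and c c' A :: real and \<sigma> h :: nat
  assumes c: "c \<ge> 2" "c' > 0" and A: "A \<ge> 0" and k: "(\<lambda>n. real (k n)) \<in> o(\<lambda>n. ln (real n))"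
  shows "(\<lambda>n. A * real (n * (\<sigma> + 1) ^ k n) powr c + 3 * real h +
      300 * real ((k n + 1) * (n * \<sigma> * n * k n + 1) + n * (\<sigma> + 1) ^ k n + n * n + 1))
    \<in> O(\<lambda>n. real n powr (c + c'))"
proof -
  \<comment> \<open>Chosen to satisfy both demands: \<open>(n powr (1 + \<epsilon>)) powr c\<close>
    costs an extra \<epsilon> * c in the exponent, and the factor \<open>k n + 1\<close>, which
    occurs twice in the time for reading the edges, costs 2 * \<epsilon>.\<close>
  define \<epsilon> where "\<epsilon> = c' / (c + 2)"
  have \<epsilon>: "\<epsilon> > 0" "\<epsilon> * c \<le> c'" "2 * \<epsilon> \<le> c'" "\<epsilon> \<le> c'"
    using c by (simp_all add: \<epsilon>_def field_simps)
  let ?P = "\<lambda>n. real n powr (c + c')"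
  have "eventually (\<lambda>n. real (\<sigma> + 1) ^ k n \<le> real n powr \<epsilon>) at_top"
    "eventually (\<lambda>n. 2 ^ k n \<le> real n powr \<epsilon>) at_top"
    using power_smallo_ln_le_powr[OF k _ \<epsilon>(1)] by simp_all
  then have "eventually (\<lambda>n. norm (A * real (n * (\<sigma> + 1) ^ k n) powr c + 3 * real h +
      300 * real ((k n + 1) * (n * \<sigma> * n * k n + 1) + n * (\<sigma> + 1) ^ k n + n * n + 1))
    \<le> (A + 3 * real h + 300 * (real \<sigma> + 4)) * norm (?P n)) at_top"
    using eventually_gt_at_top[of 0]
  proof eventually_elim
    case (elim n)
    define x where "x = real n"
    have x: "x \<ge> 1" using elim(3) by (simp add: x_def)
    have R: "real ((\<sigma> + 1) ^ k n) \<le> x powr \<epsilon>" using elim(1) by (simp add: x_def)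
    \<comment> \<open>This brings the polynomial factors in \<open>k n\<close> under the same
      estimate, with base 2.\<close>
    have "k n + 1 \<le> 2 ^ k n" by (simp add: Suc_le_eq)
    then have "real (k n + 1) \<le> 2 ^ k n"
      by (metis of_nat_le_iff of_nat_numeral of_nat_power)
    then have K: "real (k n + 1) \<le> x powr \<epsilon>" using elim(2) by (simp add: x_def)
    have powr: "x powr a \<le> x powr (c + c')" if "a \<le> c + c'" for a
      using that x by (rule powr_mono)
    have one: "1 \<le> x powr (c + c')" using powr[of 0] c x by simp
    have nR: "real (n * (\<sigma> + 1) ^ k n) \<le> x powr (1 + \<epsilon>)"
      using R x by (simp add: powr_add x_def mult_left_mono)
    have "real (n * (\<sigma> + 1) ^ k n) powr c \<le> (x powr (1 + \<epsilon>)) powr c"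
      using nR c by (intro powr_mono2) auto
    also have "\<dots> = x powr (c + \<epsilon> * c)" by (simp add: powr_powr algebra_simps)
    also have "\<dots> \<le> x powr (c + c')" using \<epsilon> by (intro powr) simp
    finally have 1: "A * real (n * (\<sigma> + 1) ^ k n) powr c \<le> A * x powr (c + c')"
      using A by (rule mult_left_mono)
    have "real ((k n + 1) * (n * \<sigma> * n * k n + 1)) \<le> real ((k n + 1) * ((\<sigma> + 1) * (n * n) * (k n + 1)))"
    proof -
      have "n * \<sigma> * n * k n + 1 \<le> (\<sigma> + 1) * (n * n) * (k n + 1)"
        using elim(3) by (cases n) (auto simp: algebra_simps)
      then show ?thesis by (simp only: of_nat_le_iff mult_le_mono2)
    qed
    also have "\<dots> = (real \<sigma> + 1) * (x * x * (real (k n + 1) * real (k n + 1)))"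
      by (simp add: x_def algebra_simps)
    also have "\<dots> \<le> (real \<sigma> + 1) * (x * x * (x powr \<epsilon> * x powr \<epsilon>))"
      using K x by (intro mult_left_mono mult_mono) auto
    also have "x * x * (x powr \<epsilon> * x powr \<epsilon>) = x powr (2 + 2 * \<epsilon>)"
    proof -
      have "x powr 2 = x * x" using x by (simp add: power2_eq_square)
      then show ?thesis by (simp only: mult_2 powr_add)
    qed
    also have "(real \<sigma> + 1) * x powr (2 + 2 * \<epsilon>) \<le> (real \<sigma> + 1) * x powr (c + c')"
      using \<epsilon> c by (intro mult_left_mono powr) auto
    finally have 2: "real ((k n + 1) * (n * \<sigma> * n * k n + 1)) \<le> (real \<sigma> + 1) * x powr (c + c')" .
    have 3: "real (n * (\<sigma> + 1) ^ k n) \<le> x powr (c + c')"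
      using nR powr[of "1 + \<epsilon>"] \<epsilon> c by linarith
    have "real (n * n) = x powr 2" using x by (simp add: x_def power2_eq_square)
    then have 4: "real (n * n) \<le> x powr (c + c')" using powr[of 2] c by simp
    have 5: "3 * real h \<le> 3 * real h * x powr (c + c')"
      using mult_left_mono[OF one, of "3 * real h"] by simp
    let ?t = "A * real (n * (\<sigma> + 1) ^ k n) powr c + 3 * real h +
      300 * real ((k n + 1) * (n * \<sigma> * n * k n + 1) + n * (\<sigma> + 1) ^ k n + n * n + 1)"
    have "?t \<le> A * x powr (c + c') + 3 * real h * x powr (c + c') +
        300 * ((real \<sigma> + 1) * x powr (c + c') + x powr (c + c') + x powr (c + c') + x powr (c + c'))"
      unfolding of_nat_add of_nat_1 by (intro add_mono mult_left_mono 1 2 3 4 5 one) simp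
    also have "\<dots> = (A + 3 * real h + 300 * (real \<sigma> + 4)) * x powr (c + c')"
      by (simp add: algebra_simps)
    finally have "?t \<le> (A + 3 * real h + 300 * (real \<sigma> + 4)) * x powr (c + c')" .
    moreover have "?t \<ge> 0" using A by simp
    ultimately show ?case by (simp add: x_def)
  qed
  then show ?thesis by (rule landau_o.bigI[rotated]) (use A in auto)
qed

theorem theorem12:
  fixes c :: real
  assumes "c > 0"
    and "\<exists>p C (q :: real poly).
      solves_all_pairs p (\<lambda>n g. C * (real n powr c * poly q (real g)))"
  shows "\<forall>G (k :: nat \<Rightarrow> nat) (c' :: real).
      numbered_cfg G \<and> (\<lambda>n. real (k n)) \<in> o(\<lambda>n. ln (real n)) \<and> c' > 0 \<longrightarrow>
      (\<exists>p T. solves_all_pairs_on_subdivisions G k p T \<and>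
             T \<in> O(\<lambda>n. real n powr (c + c')))"
proof (intro allI impI, elim conjE)
  fix G :: "(nat, nat) cfg" and k :: "nat \<Rightarrow> nat" and c' :: real
  assume G: "numbered_cfg G" and k: "(\<lambda>n. real (k n)) \<in> o(\<lambda>n. ln (real n))" and c': "c' > 0"
  obtain p C and q :: "real poly" where
    p: "solves_all_pairs p (\<lambda>n g. C * (real n powr c * poly q (real g)))"
    using assms(2) by blast
  then have c: "c \<ge> 2" by (rule solves_all_pairs_exponent_ge_2)
  define \<sigma> where "\<sigma> = card (terms G)"
  define A where "A = C * poly q (real (cfg_size G))"
  have terms: "terms G = {..<\<sigma>}" using G by (simp add: numbered_cfg_def \<sigma>_def)
  have "finite (prods G)" using G by (simp add: numbered_cfg_def wf_cfg_def)
  then obtain ps where ps: "enumerates ps (prods G)"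
    unfolding enumerates_def using finite_distinct_list by blast
  define h where "h = 6 + length (concat (map encode_prod ps))"
  define g where "g = header_bound G ps"
  define R where "R n = (\<sigma> + 1) ^ k n" for n
  obtain d where d: "\<And>D N es. wf_lgraph (terms G) D \<Longrightarrow> verts D = {..<N} \<Longrightarrow> enumerates es (edges D) \<Longrightarrow>
        \<exists>t s. terminates_in d p (encode_instance G ps N es) t s \<and> real t \<le> A * real N powr c \<and>
          correct_output G D N s"
  proof -
    from p obtain d where "\<forall>G D n ps es. numbered_cfg G \<and> wf_lgraph (terms G) D \<and> verts D = {..<n} \<and>
        enumerates ps (prods G) \<and> enumerates es (edges D) \<longrightarrow>
        (\<exists>t s. terminates_in d p (encode_instance G ps n es) t s \<and>
          real t \<le> C * (real n powr c * poly q (real (cfg_size G))) \<and> correct_output G D n s)"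
      unfolding solves_all_pairs_def by blast
    then show thesis
      using G ps by (intro that[of d]) (simp add: A_def mult_ac)
  qed
  \<comment> \<open>The run on a single vertex without edges takes nonnegative time, which fixes the
    sign of \<open>A\<close>. Monotonicity of the bound in \<open>N\<close> depends on it.\<close>
  have A: "A \<ge> 0"
  proof -
    have "wf_lgraph (terms G) \<lparr>verts = {..<1::nat}, edges = {}\<rparr>"
      by (simp add: wf_lgraph_def lessThan_empty_iff)
    from d[OF this, of 1 "[]"] obtain t where "real t \<le> A * real 1 powr c"
      by (auto simp: enumerates_def)
    then show ?thesis using of_nat_0_le_iff[of t, where 'a = real] by simp
  qed
  \<comment> \<open>Exponent 1 is enough here: this estimate serves the word size, where any
    polynomial bound will do.\<close>
  have "eventually (\<lambda>n. real (\<sigma> + 1) ^ k n \<le> real n powr 1) at_top"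
    by (rule power_smallo_ln_le_powr[OF k]) auto
  then have "eventually (\<lambda>n. R n \<le> n) at_top"
    by eventually_elim (simp add: R_def flip: of_nat_power of_nat_Suc)
  then obtain C0 where C0: "\<And>n. n > 0 \<Longrightarrow> R n \<le> C0 * n"
    using linear_bound_of_eventually by blast
  \<comment> \<open>The sum of all constants, so that \<open>W\<close> times the size
    \<open>M\<close> of the input dominates every parameter in \<open>word_bounds\<close>.\<close>
  define W where "W = C0 + \<sigma> + h + g + 20"
  define T where "T n = A * real (n * (\<sigma> + 1) ^ k n) powr c + 3 * real h +
      300 * real ((k n + 1) * (n * \<sigma> * n * k n + 1) + n * (\<sigma> + 1) ^ k n + n * n + 1)" for n
  have "solves_all_pairs_on_subdivisions G k (reduction G ps p) T"
    unfolding solves_all_pairs_on_subdivisions_def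
  \<comment> \<open>The factor \<open>W + 1\<close> replaces \<open>W * M\<close> by a power of
    \<open>M\<close>; 5 and \<open>d + 1\<close> are the exponents from
    \<open>word_bounds\<close>.\<close>
  proof (rule exI[of _ "(W + 1) * 5 * (d + 1)"], intro allI impI, elim conjE)
    fix D D' :: "(nat, nat) lgraph" and n m :: nat and es :: "(nat \<times> nat \<times> nat) list"
    assume D: "wf_lgraph (terms G) D" and D': "wf_lgraph (terms G) D'"
      and sub: "k_subdivision_graph (k n) D D'" and verts: "verts D' = {..<n}" "verts D = {..<n + m}"
      and es: "enumerates es (edges D)"
    let ?xs = "encode_subdivision n m es"
    define M where "M = length ?xs + Max (set ?xs)"
    define B where "B = M ^ ((W + 1) * 5 * (d + 1))"
    have n: "n > 0" using D' verts by (auto simp: wf_lgraph_def)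
    have length_es: "length es \<le> n * \<sigma> * n * k n"
    proof -
      have "length es = card (edges D)"
        using es distinct_card[of es] by (simp add: enumerates_def)
      also have "\<dots> \<le> n * \<sigma> * n * k n"
        using k_subdivision_graph_card_edges[OF D' _ sub] by (simp add: verts terms)
      finally show ?thesis .
    qed
    \<comment> \<open>The input has at least three entries, among them \<open>n\<close> and
      \<open>m\<close>; so \<open>M\<close> exceeds 2, as \<open>mult_le_power\<close>
      demands.\<close>
    have M: "3 + n \<le> M" "3 + m \<le> M" "length es \<le> M"
      using Max_ge[of "set ?xs" n] Max_ge[of "set ?xs" m]
      unfolding M_def by (auto simp: encode_subdivision_def)
    define Y where "Y = W * M"
    have Y: "n \<le> Y" "R n \<le> Y" "length es \<le> Y" "\<sigma> + 1 \<le> Y" "n + m \<le> 2 * Y" "h + g \<le> Y" "20 \<le> Y"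
    proof -
      have "M \<le> Y" "W \<le> Y" using M by (simp_all add: Y_def W_def)
      moreover have "C0 * n \<le> Y"
        unfolding Y_def using M by (intro mult_le_mono) (simp_all add: W_def)
      moreover have "\<sigma> + 1 \<le> W" "h + g \<le> W" "20 \<le> W" by (simp_all add: W_def)
      ultimately show "n \<le> Y" "R n \<le> Y" "length es \<le> Y" "\<sigma> + 1 \<le> Y" "n + m \<le> 2 * Y" "h + g \<le> Y" "20 \<le> Y"
        using M C0[OF n] by linarith+
    qed
    have "Y \<le> M ^ (W + 1)"
      unfolding Y_def using M by (intro mult_le_power) simp
    then have "(Y ^ 5) ^ (d + 1) \<le> ((M ^ (W + 1)) ^ 5) ^ (d + 1)"
      by (intro power_mono) auto
    then have B: "(Y ^ 5) ^ (d + 1) \<le> B"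
      by (simp only: B_def power_mult)
    note bounds = word_bounds[OF Y, of d, THEN order.trans, OF B, unfolded R_def]
    obtain tgt word where sd: "subdivided_graph {..<n + m} {..<n} (edges D) {..<\<sigma>} (k n) tgt word"
      using k_subdivision_graph_subdivided[OF D D' sub] unfolding verts terms by blast
    interpret subdivided_graph "{..<n + m}" "{..<n}" "edges D" "{..<\<sigma>}" "k n" tgt word
      by (rule sd)
    interpret merging "n + m" n "edges D" \<sigma> "k n" tgt word es B h
      by unfold_locales (use n es bounds in auto)
    have "\<exists>t s N. exec B (reduction G ps p) (input_state ?xs) t s \<and>
      correct_output G D n s \<and> n \<le> N \<and> N \<le> n * (\<sigma> + 1) ^ k n \<and>
      real t \<le> A * real N powr c + 3 * h + 300 * ((k n + 1) * (length es + 1) + N + n * n + 1)"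
      by (rule reduction_correct[where d = d])
        (use G ps d verts bounds in \<open>auto simp: \<sigma>_def h_def g_def\<close>)
    then obtain t s N where run: "exec B (reduction G ps p) (input_state ?xs) t s"
      "correct_output G D n s" "N \<le> n * (\<sigma> + 1) ^ k n"
      "real t \<le> A * real N powr c + 3 * h + 300 * ((k n + 1) * (length es + 1) + N + n * n + 1)"
      by blast
    have "real N \<le> real (n * (\<sigma> + 1) ^ k n)"
      using run(3) by (simp only: of_nat_le_iff)
    then have "A * real N powr c \<le> A * real (n * (\<sigma> + 1) ^ k n) powr c"
      by (intro mult_left_mono powr_mono2) (use c A in simp_all)
    moreover have "(k n + 1) * (length es + 1) + N + n * n + 1 \<le>
        (k n + 1) * (n * \<sigma> * n * k n + 1) + n * (\<sigma> + 1) ^ k n + n * n + 1"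
      using run(3) length_es by (intro add_mono mult_le_mono2) auto
    then have "real ((k n + 1) * (length es + 1) + N + n * n + 1) \<le>
        real ((k n + 1) * (n * \<sigma> * n * k n + 1) + n * (\<sigma> + 1) ^ k n + n * n + 1)"
      by (simp only: of_nat_le_iff)
    ultimately have "real t \<le> T n"
      using run(4) unfolding T_def by simp
    then show "\<exists>t s. terminates_in ((W + 1) * 5 * (d + 1)) (reduction G ps p) ?xs t s \<and>
        real t \<le> T n \<and> correct_output G D n s"
      using run unfolding terminates_in_def B_def M_def by blast
  qed
  moreover have "T \<in> O(\<lambda>n. real n powr (c + c'))"
    unfolding T_def using c c' A k by (rule subdivision_time_bound)
  ultimately show "\<exists>p T. solves_all_pairs_on_subdivisions G k p T \<and>
      T \<in> O(\<lambda>n. real n powr (c + c'))"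
    by blast
qed

end
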